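(* Let $\Omega$ be a compact metric space, $T:\Omega\to\Omega$ a homeomorphism, and $f:\Omega\to\mathbb{R}$ a continuous function. Assume that $(\Omega,T)$ is topologically transitive, let $\omega_0\in\Omega$ be such that its orbit $\mathrm{Orb}(\omega_0)=\{T^n\omega_0:n\in\mathbb{Z}\}$ satisfies $\overline{\mathrm{Orb}(\omega_0)}=\Omega$, and let $\Sigma=\sigma(H_{\omega_0})$. Then $\sigma(H_\omega)\subset\Sigma$ for all $\omega\in\Omega$. Moreover, $$\Sigma=\{E\in\mathbb{R}:(T,A^{(E-f)})\text{ is not uniformly hyperbolic}\}.$$
   Context: For $\omega\in\Omega$, $H_\omega$ is the operator on $\ell^2(\mathbb{Z})$ given by $(H_\omega\psi)_n=\psi_{n+1}+\psi_{n-1}+f(T^n\omega)\psi_n$, and $\sigma(H_\omega)$ is its spectrum. For $E\in\mathbb{R}$, $A^{(E-f)}:\Omega\to\mathrm{SL}(2,\mathbb{R})$ is $A^{(E-f)}(\omega)=\begin{pmatrix}E-f(\omega)&-1\\1&0\end{pmatrix}$. $(\Omega,T)$ is topologically transitive if there is a dense $T$-orbit $\{T^n\omega:n\in\mathbb{Z}\}$. For a bounded map $A:\Omega\to\mathrm{SL}(2,\mathbb{R})$, let $A_n(\omega)=A(T^{n-1}\omega)\cdots A(\omega)$ for $n\ge1$, $A_0(\omega)=I_2$, and $A_n(\omega)=[A_{-n}(T^{n}\omega)]^{-1}$ for $n\le-1$. $\mathbb{RP}^1=\mathbb{R}/(\pi\mathbb{Z})$ is the set of lines through the origin of $\mathbb{R}^2$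 (identified with angles), $B\cdot\theta$ is the induced action of $B\in\mathrm{SL}(2,\mathbb{R})$, and $\vec v\in\theta$ means $\vec v$ lies on the line $\theta$. $(T,A)$ is uniformly hyperbolic if there are maps $u,s:\Omega\to\mathbb{RP}^1$ (no regularity required) such that (1) $A(\omega)\cdot u(\omega)=u(T\omega)$ and $A(\omega)\cdot s(\omega)=s(T\omega)$ for all $\omega\in\Omega$; (2) there exist $C>0$, $\lambda>1$ such that $\|A_{-n}(\omega)\vec v\|\le C\lambda^{-n}$ and $\|A_n(\omega)\vec w\|\le C\lambda^{-n}$ for all $n\ge1$, all $\omega\in\Omega$ and all unit vectors $\vec v\in u(\omega)$, $\vec w\in s(\omega)$. *)

theory Defs
  imports "HOL-Analysis.Analysis"
begin

definition square_summable :: "(int \<Rightarrow> complex) \<Rightarrow> bool" where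
  "square_summable \<psi> \<longleftrightarrow> (\<lambda>n. (cmod (\<psi> n))\<^sup>2) summable_on UNIV"

lemma square_summable_0: "square_summable (\<lambda>_. 0)"
  by (simp add: square_summable_def)

lemma square_summable_mult:
  assumes "square_summable \<psi>" and "\<And>n. cmod (c n) \<le> B"
  shows "square_summable (\<lambda>n. c n * \<psi> n)"
proof -
  have "(\<lambda>n. B\<^sup>2 * (cmod (\<psi> n))\<^sup>2) summable_on UNIV"
    using assms(1) unfolding square_summable_def by (rule summable_on_cmult_right)
  then show ?thesis
    unfolding square_summable_def
    by (rule summable_on_comparison_test)
      (auto simp: norm_mult power_mult_distrib intro!: mult_right_mono power_mono assms(2))
qed

lemma square_summable_add:
  assumes "square_summable \<psi>" and "square_summable \<phi>"
  shows "square_summable (\<lambda>n. \<psi> n + \<phi> n)"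
proof -
  have le: "(cmod (a + b))\<^sup>2 \<le> 2 * (cmod a)\<^sup>2 + 2 * (cmod b)\<^sup>2" for a b :: complex
  proof -
    have "(cmod (a + b))\<^sup>2 \<le> (cmod a + cmod b)\<^sup>2"
      by (intro power_mono norm_triangle_ineq) auto
    also have "\<dots> \<le> 2 * (cmod a)\<^sup>2 + 2 * (cmod b)\<^sup>2"
      using sum_squares_bound[of "cmod a" "cmod b"] by (simp add: power2_sum)
    finally show ?thesis .
  qed
  have "(\<lambda>n. 2 * (cmod (\<psi> n))\<^sup>2 + 2 * (cmod (\<phi> n))\<^sup>2) summable_on UNIV"
    using assms unfolding square_summable_def
    by (intro summable_on_add summable_on_cmult_right)
  then show ?thesis
    unfolding square_summable_def
    by (rule summable_on_comparison_test) (auto intro: le)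
qed

lemma square_summable_shift:
  assumes "square_summable \<psi>"
  shows "square_summable (\<lambda>n. \<psi> (n + k))"
proof -
  have "bij_betw (\<lambda>n. n + k) UNIV UNIV"
    by (rule bij_betw_byWitness[where f' = "\<lambda>n. n - k"]) auto
  from summable_on_reindex_bij_betw[OF this, of "\<lambda>n. (cmod (\<psi> n))\<^sup>2"] show ?thesis
    using assms by (simp add: square_summable_def)
qed

typedef ell2 = "{\<psi> :: int \<Rightarrow> complex. square_summable \<psi>}"
  by (rule exI[of _ "\<lambda>_. 0"]) (simp add: square_summable_0)

setup_lifting type_definition_ell2

instantiation ell2 :: real_vector
begin

lift_definition zero_ell2 :: ell2 is "\<lambda>_. 0"
  by (rule square_summable_0)

lift_definition plus_ell2 :: "ell2 \<Rightarrow> ell2 \<Rightarrow> ell2" is "\<lambda>\<psi> \<phi> n. \<psi> n + \<phi> n"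
  by (rule square_summable_add)

lift_definition uminus_ell2 :: "ell2 \<Rightarrow> ell2" is "\<lambda>\<psi> n. - \<psi> n"
  by (simp add: square_summable_def)

lift_definition minus_ell2 :: "ell2 \<Rightarrow> ell2 \<Rightarrow> ell2" is "\<lambda>\<psi> \<phi> n. \<psi> n - \<phi> n"
proof -
  fix \<psi> \<phi> :: "int \<Rightarrow> complex"
  assume "square_summable \<psi>" "square_summable \<phi>"
  then have "square_summable (\<lambda>n. \<psi> n + - \<phi> n)"
    by (intro square_summable_add) (simp_all add: square_summable_def)
  then show "square_summable (\<lambda>n. \<psi> n - \<phi> n)" by simp
qed

lift_definition scaleR_ell2 :: "real \<Rightarrow> ell2 \<Rightarrow> ell2" is "\<lambda>r \<psi> n. complex_of_real r * \<psi> n"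
  by (erule square_summable_mult) (rule order_refl)

instance
  by standard (transfer; auto simp: algebra_simps)+

end

lift_definition scaleC :: "complex \<Rightarrow> ell2 \<Rightarrow> ell2" is "\<lambda>c \<psi> n. c * \<psi> n"
  by (erule square_summable_mult) (rule order_refl)

instantiation ell2 :: real_normed_vector
begin

lift_definition norm_ell2 :: "ell2 \<Rightarrow> real" is
  "\<lambda>\<psi>. sqrt (\<Sum>\<^sub>\<infinity>n. (cmod (\<psi> n))\<^sup>2)" .

definition dist_ell2 :: "ell2 \<Rightarrow> ell2 \<Rightarrow> real" where
  "dist_ell2 \<psi> \<phi> = norm (\<psi> - \<phi>)"

definition sgn_ell2 :: "ell2 \<Rightarrow> ell2" where
  "sgn_ell2 \<psi> = \<psi> /\<^sub>R norm \<psi>"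

definition uniformity_ell2 :: "(ell2 \<times> ell2) filter" where
  "uniformity_ell2 = (INF e\<in>{0<..}. principal {(\<psi>, \<phi>). dist \<psi> \<phi> < e})"

definition open_ell2 :: "ell2 set \<Rightarrow> bool" where
  "open_ell2 S \<longleftrightarrow> (\<forall>\<psi>\<in>S. \<forall>\<^sub>F (\<psi>', \<phi>) in uniformity. \<psi>' = \<psi> \<longrightarrow> \<phi> \<in> S)"

instance
proof
  fix \<psi> \<phi> :: ell2 and r :: real
  show "norm \<psi> = 0 \<longleftrightarrow> \<psi> = 0"
  proof transfer
    fix \<psi> :: "int \<Rightarrow> complex"
    assume s: "square_summable \<psi>"
    show "sqrt (\<Sum>\<^sub>\<infinity>n. (cmod (\<psi> n))\<^sup>2) = 0 \<longleftrightarrow> \<psi> = (\<lambda>_. 0)"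
    proof
      assume "sqrt (\<Sum>\<^sub>\<infinity>n. (cmod (\<psi> n))\<^sup>2) = 0"
      then have le: "(\<Sum>\<^sub>\<infinity>n. (cmod (\<psi> n))\<^sup>2) \<le> 0" by simp
      have "(cmod (\<psi> n))\<^sup>2 = 0" for n
        by (rule nonneg_infsum_le_0D[OF le]) (use s in \<open>auto simp: square_summable_def\<close>)
      then show "\<psi> = (\<lambda>_. 0)" by auto
    qed simp
  qed
  show "norm (\<psi> + \<phi>) \<le> norm \<psi> + norm \<phi>"
  proof transfer
    fix \<psi> \<phi> :: "int \<Rightarrow> complex"
    assume s: "square_summable \<psi>" "square_summable \<phi>"
    let ?a = "sqrt (\<Sum>\<^sub>\<infinity>n. (cmod (\<psi> n))\<^sup>2)" and ?b = "sqrt (\<Sum>\<^sub>\<infinity>n. (cmod (\<phi> n))\<^sup>2)"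
    have part: "L2_set (\<lambda>n. cmod (\<xi> n)) F \<le> sqrt (\<Sum>\<^sub>\<infinity>n. (cmod (\<xi> n))\<^sup>2)"
      if "square_summable \<xi>" "finite F" for \<xi> F
      using that unfolding L2_set_def square_summable_def
      by (intro real_sqrt_le_mono finite_sum_le_infsum) auto
    have "(\<Sum>\<^sub>\<infinity>n. (cmod (\<psi> n + \<phi> n))\<^sup>2) \<le> (?a + ?b)\<^sup>2"
    proof (rule infsum_le_finite_sums)
      show "(\<lambda>n. (cmod (\<psi> n + \<phi> n))\<^sup>2) summable_on UNIV"
        using square_summable_add[OF s] by (simp add: square_summable_def)
      fix F :: "int set"
      assume F: "finite F"
      have "L2_set (\<lambda>n. cmod (\<psi> n + \<phi> n)) F \<le> L2_set (\<lambda>n. cmod (\<psi> n) + cmod (\<phi> n)) F"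
        by (intro L2_set_mono norm_triangle_ineq) auto
      also have "\<dots> \<le> L2_set (\<lambda>n. cmod (\<psi> n)) F + L2_set (\<lambda>n. cmod (\<phi> n)) F"
        by (rule L2_set_triangle_ineq)
      also have "\<dots> \<le> ?a + ?b"
        by (intro add_mono part s F)
      finally have "L2_set (\<lambda>n. cmod (\<psi> n + \<phi> n)) F \<le> ?a + ?b" .
      then have "(L2_set (\<lambda>n. cmod (\<psi> n + \<phi> n)) F)\<^sup>2 \<le> (?a + ?b)\<^sup>2"
        by (rule power_mono) auto
      then show "(\<Sum>n\<in>F. (cmod (\<psi> n + \<phi> n))\<^sup>2) \<le> (?a + ?b)\<^sup>2"
        by (simp add: L2_set_def sum_nonneg)
    qed
    then show "sqrt (\<Sum>\<^sub>\<infinity>n. (cmod (\<psi> n + \<phi> n))\<^sup>2) \<le> ?a + ?b"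
      by (intro real_le_lsqrt) (auto intro!: add_nonneg_nonneg infsum_nonneg)
  qed
  show "norm (r *\<^sub>R \<psi>) = \<bar>r\<bar> * norm \<psi>"
    by transfer
      (simp add: norm_mult power_mult_distrib infsum_cmult_right' real_sqrt_mult)
qed (simp_all add: dist_ell2_def sgn_ell2_def uniformity_ell2_def open_ell2_def)

end

definition bounded_clinear :: "(ell2 \<Rightarrow> ell2) \<Rightarrow> bool" where
  "bounded_clinear R \<longleftrightarrow> bounded_linear R \<and> (\<forall>c \<psi>. R (scaleC c \<psi>) = scaleC c (R \<psi>))"

definition spectrum :: "(ell2 \<Rightarrow> ell2) \<Rightarrow> complex set" where
  "spectrum H = {z. \<not> (\<exists>R. bounded_clinear R \<and>
      (\<forall>\<psi>. R (H \<psi> - scaleC z \<psi>) = \<psi>) \<and> (\<forall>\<psi>. H (R \<psi>) - scaleC z (R \<psi>) = \<psi>))}"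

text \<open>This is meaningful only for a bounded potential \<open>V\<close>: otherwise the sequence on the right
  need not be square-summable. See \<open>Rep_schrodinger\<close>.\<close>

definition schrodinger :: "(int \<Rightarrow> real) \<Rightarrow> ell2 \<Rightarrow> ell2" where
  "schrodinger V \<psi> =
     Abs_ell2 (\<lambda>n. Rep_ell2 \<psi> (n + 1) + Rep_ell2 \<psi> (n - 1) + complex_of_real (V n) * Rep_ell2 \<psi> n)"

lemma Rep_schrodinger:
  assumes "bounded (range V)"
  shows "Rep_ell2 (schrodinger V \<psi>) n =
           Rep_ell2 \<psi> (n + 1) + Rep_ell2 \<psi> (n - 1) + complex_of_real (V n) * Rep_ell2 \<psi> n"
proof -
  obtain B where "\<And>n. \<bar>V n\<bar> \<le> B"
    using assms unfolding bounded_iff by auto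
  then have B: "cmod (complex_of_real (V n)) \<le> B" for n by simp
  have s: "square_summable (Rep_ell2 \<psi>)"
    using Rep_ell2[of \<psi>] by simp
  have "square_summable (\<lambda>n. Rep_ell2 \<psi> (n + 1) + Rep_ell2 \<psi> (n - 1) + complex_of_real (V n) * Rep_ell2 \<psi> n)"
    using square_summable_shift[OF s, of 1] square_summable_shift[OF s, of "-1"]
      square_summable_mult[of "Rep_ell2 \<psi>" "\<lambda>n. complex_of_real (V n)", OF s B]
    by (intro square_summable_add) simp_all
  then show ?thesis
    by (simp add: schrodinger_def Abs_ell2_inverse)
qed

definition iterate :: "('w \<Rightarrow> 'w) \<Rightarrow> int \<Rightarrow> 'w \<Rightarrow> 'w" where
  "iterate T n \<omega> = (if n \<ge> 0 then (T ^^ nat n) \<omega> else (inv T ^^ nat (- n)) \<omega>)"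

definition orbit :: "('w \<Rightarrow> 'w) \<Rightarrow> 'w \<Rightarrow> 'w set" where
  "orbit T \<omega> = range (\<lambda>n. iterate T n \<omega>)"

definition topologically_transitive :: "('w::topological_space \<Rightarrow> 'w) \<Rightarrow> bool" where
  "topologically_transitive T \<longleftrightarrow> (\<exists>\<omega>. closure (orbit T \<omega>) = UNIV)"

definition dyn_schrodinger :: "('w \<Rightarrow> 'w) \<Rightarrow> ('w \<Rightarrow> real) \<Rightarrow> 'w \<Rightarrow> ell2 \<Rightarrow> ell2" where
  "dyn_schrodinger T f \<omega> = schrodinger (\<lambda>n. f (iterate T n \<omega>))"

fun forward_cocycle :: "('w \<Rightarrow> 'w) \<Rightarrow> ('w \<Rightarrow> real^2^2) \<Rightarrow> nat \<Rightarrow> 'w \<Rightarrow> real^2^2" where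
  "forward_cocycle T A 0 \<omega> = mat 1"
| "forward_cocycle T A (Suc n) \<omega> = A ((T ^^ n) \<omega>) ** forward_cocycle T A n \<omega>"

definition cocycle :: "('w \<Rightarrow> 'w) \<Rightarrow> ('w \<Rightarrow> real^2^2) \<Rightarrow> int \<Rightarrow> 'w \<Rightarrow> real^2^2" where
  "cocycle T A n \<omega> =
     (if n \<ge> 0 then forward_cocycle T A (nat n) \<omega>
      else matrix_inv (forward_cocycle T A (nat (- n)) (iterate T n \<omega>)))"

definition RP1 :: "(real^2) set set" where
  "RP1 = {L. subspace L \<and> dim L = 1}"

definition line_action :: "real^2^2 \<Rightarrow> (real^2) set \<Rightarrow> (real^2) set" where
  "line_action B L = (\<lambda>v. B *v v) ` L"

text \<open>The notion is intended for bounded \<open>A\<close> with values in SL(2,R).\<close>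

definition uniformly_hyperbolic :: "('w \<Rightarrow> 'w) \<Rightarrow> ('w \<Rightarrow> real^2^2) \<Rightarrow> bool" where
  "uniformly_hyperbolic T A \<longleftrightarrow>
    (\<exists>u s. range u \<subseteq> RP1 \<and> range s \<subseteq> RP1 \<and>
       (\<forall>\<omega>. line_action (A \<omega>) (u \<omega>) = u (T \<omega>) \<and> line_action (A \<omega>) (s \<omega>) = s (T \<omega>)) \<and>
       (\<exists>C>0. \<exists>l>1. \<forall>n::nat. n \<ge> 1 \<longrightarrow> (\<forall>\<omega>.
          (\<forall>v \<in> u \<omega>. norm v = 1 \<longrightarrow> norm (cocycle T A (- int n) \<omega> *v v) \<le> C * l powi (- int n)) \<and>
          (\<forall>w \<in> s \<omega>. norm w = 1 \<longrightarrow> norm (cocycle T A (int n) \<omega> *v w) \<le> C * l powi (- int n)))))"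

definition transfer_matrix :: "('w \<Rightarrow> real) \<Rightarrow> real \<Rightarrow> 'w \<Rightarrow> real^2^2" where
  "transfer_matrix f E \<omega> = vector [vector [E - f \<omega>, -1], vector [1, 0]]"

lemma det_transfer_matrix: "det (transfer_matrix f E \<omega>) = 1"
  by (simp add: transfer_matrix_def det_2)

end

theory Submission
  imports Defs
begin

text \<open>
  Write \<open>W n = f (T\<^sup>n \<omega>) - z\<close>. If \<open>z\<close> is outside \<open>\<Sigma>\<close>, then \<open>H_\<omega>\<^sub>0 - z\<close> is bounded below on finitely supported
  sequences, and by density of the orbit and continuity of \<open>f\<close> the same bound holds for every \<open>H_\<omega> - z\<close>.
  Testing it on solutions of \<open>(H_\<omega> - z) x = 0\<close> cut off to an interval bounds the mass of \<open>x\<close> inside the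
  interval by its size at the two ends. With compactness of the unit sphere of initial data, this gives
  solutions that are square summable at \<open>\<plusminus>\<infinity>\<close>; a geometric-series argument makes their decay exponential,
  with constants independent of \<open>\<omega>\<close>. For real \<open>z\<close> this is uniform hyperbolicity.
  Conversely, two such families of contracted solutions are uniformly transversal, so the Green kernel
  built from them decays exponentially off the diagonal; by the Schur test it defines a bounded inverse
  of \<open>H_\<omega> - z\<close>. Non-real \<open>z\<close> are covered by the lower bound \<open>\<bar>Im z\<bar>\<close>.
\<close>

section \<open>Exponentially decaying kernels on \<open>l\<^sup>2\<close>\<close>

lemma square_summable_Rep: "square_summable (Rep_ell2 \<psi>)"
  using Rep_ell2[of \<psi>] by simp

lemma norm_ell2_sq: "(norm \<psi>)\<^sup>2 = (\<Sum>\<^sub>\<infinity>n. (cmod (Rep_ell2 \<psi> n))\<^sup>2)"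
  by (simp add: norm_ell2.rep_eq infsum_nonneg)

lemma summable_geometric_int:
  fixes r :: real
  assumes "0 < r" "r < 1"
  shows "(\<lambda>j::int. r ^ nat \<bar>j\<bar>) summable_on UNIV"
proof -
  have g: "(\<lambda>n::nat. r ^ n) summable_on UNIV"
    using assms by (intro norm_summable_imp_summable_on) (auto simp: norm_power)
  have "(\<lambda>j::int. r ^ nat \<bar>j\<bar>) summable_on range int"
    using g by (subst summable_on_reindex) (auto simp: o_def)
  moreover have "(\<lambda>j::int. r ^ nat \<bar>j\<bar>) summable_on range (\<lambda>n. - 1 - int n)"
  proof (subst summable_on_reindex)
    show "inj (\<lambda>n. - 1 - int n)" by (auto simp: inj_def)
    have "nat \<bar>- 1 - int n\<bar> = Suc n" for n by auto
    then have "((\<lambda>j::int. r ^ nat \<bar>j\<bar>) \<circ> (\<lambda>n. - 1 - int n)) = (\<lambda>n. r * r ^ n)"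
      by (simp add: o_def fun_eq_iff)
    then show "((\<lambda>j::int. r ^ nat \<bar>j\<bar>) \<circ> (\<lambda>n. - 1 - int n)) summable_on UNIV"
      using summable_on_cmult_right[OF g, of r] by simp
  qed
  moreover have "range int \<inter> range (\<lambda>n. - 1 - int n) = {}" by auto
  ultimately have "(\<lambda>j::int. r ^ nat \<bar>j\<bar>) summable_on (range int \<union> range (\<lambda>n. - 1 - int n))"
    by (rule summable_on_Un_disjoint)
  also have "range int \<union> range (\<lambda>n. - 1 - int n) = UNIV"
  proof (intro set_eqI iffI UNIV_I)
    fix j :: int
    show "j \<in> range int \<union> range (\<lambda>n. - 1 - int n)"
    proof (cases "j \<ge> 0")
      case True
      then have "j = int (nat j)" by simp
      then show ?thesis by blast
    next
      case False
      then have "j = - 1 - int (nat (- 1 - j))" by simp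
      then show ?thesis by blast
    qed
  qed
  finally show ?thesis .
qed

section \<open>The Schur test for exponentially decaying kernels\<close>

lemma has_sum_finite_sum:
  fixes f :: "'i \<Rightarrow> 'a \<Rightarrow> real"
  assumes "finite F" "\<And>i. i \<in> F \<Longrightarrow> f i summable_on A"
  shows "((\<lambda>x. \<Sum>i\<in>F. f i x) has_sum (\<Sum>i\<in>F. infsum (f i) A)) A"
  using assms by (induction F rule: finite_induct) (auto intro!: has_sum_add)

text \<open>Cauchy-Schwarz after splitting each weight as \<open>sqrt (k m) * sqrt (k m)\<close>.
  With a kernel row as weight this is the pointwise half of the Schur test.\<close>

lemma infsum_weighted_Cauchy_Schwarz:
  fixes k x :: "'a \<Rightarrow> real"
  assumes "\<And>m. 0 \<le> k m" "\<And>m. 0 \<le> x m"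
    and k: "k summable_on UNIV" and kx: "(\<lambda>m. k m * (x m)\<^sup>2) summable_on UNIV"
  shows "(\<lambda>m. k m * x m) summable_on UNIV"
    and "(\<Sum>\<^sub>\<infinity>m. k m * x m)\<^sup>2 \<le> (\<Sum>\<^sub>\<infinity>m. k m) * (\<Sum>\<^sub>\<infinity>m. k m * (x m)\<^sup>2)"
proof -
  \<comment> \<open>This makes \<open>k m * x m\<close> dominated by the summable family
    \<open>k m + k m * (x m)\<^sup>2\<close>.\<close>
  have le: "t \<le> 1 + t\<^sup>2" for t :: real
    using sum_squares_bound[of t "1/2"] by (simp add: power2_eq_square)
  have "(\<lambda>m. k m + k m * (x m)\<^sup>2) summable_on UNIV"
    by (intro summable_on_add k kx)
  then show s: "(\<lambda>m. k m * x m) summable_on UNIV"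
    by (rule summable_on_comparison_test)
      (use assms(1,2) mult_left_mono[OF le assms(1)] in \<open>simp_all add: distrib_left\<close>)
  let ?S = "(\<Sum>\<^sub>\<infinity>m. k m)" and ?X = "(\<Sum>\<^sub>\<infinity>m. k m * (x m)\<^sup>2)"
  have "(\<Sum>\<^sub>\<infinity>m. k m * x m) \<le> sqrt (?S * ?X)"
  proof (rule infsum_le_finite_sums[OF s])
    fix F :: "'a set" assume F: "finite F"
    have "(\<Sum>m\<in>F. k m * x m)\<^sup>2 = (\<Sum>m\<in>F. sqrt (k m) * (sqrt (k m) * x m))\<^sup>2"
      using assms(1) by (simp add: mult.assoc[symmetric])
    also have "\<dots> \<le> (\<Sum>m\<in>F. (sqrt (k m))\<^sup>2) * (\<Sum>m\<in>F. (sqrt (k m) * x m)\<^sup>2)"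
      by (rule Cauchy_Schwarz_ineq_sum)
    also have "\<dots> = (\<Sum>m\<in>F. k m) * (\<Sum>m\<in>F. k m * (x m)\<^sup>2)"
      using assms(1) by (simp add: power_mult_distrib)
    also have "\<dots> \<le> ?S * ?X"
      using assms(1,2) F
      by (intro mult_mono finite_sum_le_infsum k kx sum_nonneg infsum_nonneg) auto
    finally show "(\<Sum>m\<in>F. k m * x m) \<le> sqrt (?S * ?X)"
      by (rule real_le_rsqrt)
  qed
  moreover have "0 \<le> (\<Sum>\<^sub>\<infinity>m. k m * x m)" using assms(1,2) by (intro infsum_nonneg) auto
  ultimately show "(\<Sum>\<^sub>\<infinity>m. k m * x m)\<^sup>2 \<le> ?S * ?X"
    using assms(1,2) by (smt (verit) infsum_nonneg mult_nonneg_nonneg power_mono real_sqrt_pow2 zero_le_power2)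
qed

text \<open>\<open>infsum\<close> is 0 for a family that is not summable; for decaying kernels and
  square-summable \<phi> the value is a genuine sum by \<open>summable_kernel\<close>.\<close>

definition kernel_op :: "(int \<Rightarrow> int \<Rightarrow> complex) \<Rightarrow> (int \<Rightarrow> complex) \<Rightarrow> int \<Rightarrow> complex" where
  "kernel_op G \<phi> n = (\<Sum>\<^sub>\<infinity>m. G n m * \<phi> m)"

locale exp_kernel =
  fixes G :: "int \<Rightarrow> int \<Rightarrow> complex" and C r :: real
  assumes C: "0 < C" and r: "0 < r" "r < 1"
    and G_le: "cmod (G n m) \<le> C * r ^ nat \<bar>n - m\<bar>"
begin

text \<open>The weight depends only on the distance of the two indices, so this one number bounds
  all row sums and all column sums. It is the Schur bound on the operator norm.\<close>

definition total :: real where "total = (\<Sum>\<^sub>\<infinity>j::int. C * r ^ nat \<bar>j\<bar>)"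

lemma summable_weight: "(\<lambda>j::int. C * r ^ nat \<bar>j\<bar>) summable_on UNIV"
  by (intro summable_on_cmult_right summable_geometric_int r)

lemma bij_diff: "bij_betw (\<lambda>m::int. n - m) UNIV UNIV"
  by (rule bij_betw_byWitness[where f' = "\<lambda>m. n - m"]) auto

lemma summable_row: "(\<lambda>m. C * r ^ nat \<bar>n - m\<bar>) summable_on UNIV"
  and infsum_row: "(\<Sum>\<^sub>\<infinity>m. C * r ^ nat \<bar>n - m\<bar>) = total"
  using summable_on_reindex_bij_betw[OF bij_diff[of n], of "\<lambda>j. C * r ^ nat \<bar>j\<bar>"]
    infsum_reindex_bij_betw[OF bij_diff[of n], of "\<lambda>j. C * r ^ nat \<bar>j\<bar>"] summable_weight
  by (simp_all add: total_def)

lemma weight_le: "C * r ^ nat \<bar>j\<bar> \<le> C"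
  using C r by (simp add: power_le_one)

lemma total_nonneg: "0 \<le> total"
  unfolding total_def using C r by (intro infsum_nonneg) auto

context
  fixes \<phi> :: "int \<Rightarrow> complex" assumes \<phi>: "square_summable \<phi>"
begin

lemma summable_row_sq: "(\<lambda>m. C * r ^ nat \<bar>n - m\<bar> * (cmod (\<phi> m))\<^sup>2) summable_on UNIV"
proof (rule summable_on_comparison_test)
  show "(\<lambda>m. C * (cmod (\<phi> m))\<^sup>2) summable_on UNIV"
    using \<phi> unfolding square_summable_def by (rule summable_on_cmult_right)
  show "C * r ^ nat \<bar>n - m\<bar> * (cmod (\<phi> m))\<^sup>2 \<le> C * (cmod (\<phi> m))\<^sup>2" for m
    by (rule mult_right_mono[OF weight_le]) simp
qed (use C r in simp)

lemma cmod_kernel_le: "cmod (G n m * \<phi> m) \<le> C * r ^ nat \<bar>n - m\<bar> * cmod (\<phi> m)"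
  unfolding norm_mult by (rule mult_right_mono[OF G_le]) simp

lemma summable_row_norm: "(\<lambda>m. C * r ^ nat \<bar>n - m\<bar> * cmod (\<phi> m)) summable_on UNIV"
  and infsum_row_norm_sq: "(\<Sum>\<^sub>\<infinity>m. C * r ^ nat \<bar>n - m\<bar> * cmod (\<phi> m))\<^sup>2
    \<le> total * (\<Sum>\<^sub>\<infinity>m. C * r ^ nat \<bar>n - m\<bar> * (cmod (\<phi> m))\<^sup>2)"
  using infsum_weighted_Cauchy_Schwarz[of "\<lambda>m. C * r ^ nat \<bar>n - m\<bar>" "\<lambda>m. cmod (\<phi> m)",
      OF _ _ summable_row summable_row_sq] C r
  by (simp_all add: infsum_row)

lemma summable_kernel_norm: "(\<lambda>m. norm (G n m * \<phi> m)) summable_on UNIV"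
  by (rule summable_on_comparison_test[OF summable_row_norm[of n]]) (simp_all only: cmod_kernel_le norm_ge_zero)

lemma summable_kernel: "(\<lambda>m. G n m * \<phi> m) summable_on UNIV"
  by (rule abs_summable_summable) (rule summable_kernel_norm)

lemma kernel_op_sq_le: "(cmod (kernel_op G \<phi> n))\<^sup>2 \<le> total * (\<Sum>\<^sub>\<infinity>m. C * r ^ nat \<bar>n - m\<bar> * (cmod (\<phi> m))\<^sup>2)"
proof -
  have "cmod (kernel_op G \<phi> n) \<le> (\<Sum>\<^sub>\<infinity>m. norm (G n m * \<phi> m))"
    unfolding kernel_op_def by (rule norm_infsum_bound) (rule summable_kernel_norm)
  also have "\<dots> \<le> (\<Sum>\<^sub>\<infinity>m. C * r ^ nat \<bar>n - m\<bar> * cmod (\<phi> m))"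
    by (intro infsum_mono summable_kernel_norm summable_row_norm cmod_kernel_le)
  finally have "(cmod (kernel_op G \<phi> n))\<^sup>2 \<le> (\<Sum>\<^sub>\<infinity>m. C * r ^ nat \<bar>n - m\<bar> * cmod (\<phi> m))\<^sup>2"
    by (rule power_mono) auto
  also note infsum_row_norm_sq
  finally show ?thesis .
qed

text \<open>Summing the pointwise estimate over \<open>n\<close> and exchanging the sums leaves
  column sums, each at most \<open>total\<close>. Finiteness of \<open>F\<close> reduces the
  exchange to additivity of \<open>infsum\<close>.\<close>

lemma kernel_op_finite_sum_le:
  assumes F: "finite F"
  shows "(\<Sum>n\<in>F. (cmod (kernel_op G \<phi> n))\<^sup>2) \<le> total\<^sup>2 * (\<Sum>\<^sub>\<infinity>m. (cmod (\<phi> m))\<^sup>2)"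
proof -
  have "(\<Sum>n\<in>F. (cmod (kernel_op G \<phi> n))\<^sup>2)
      \<le> total * (\<Sum>n\<in>F. \<Sum>\<^sub>\<infinity>m. C * r ^ nat \<bar>n - m\<bar> * (cmod (\<phi> m))\<^sup>2)"
    unfolding sum_distrib_left by (intro sum_mono kernel_op_sq_le)
  also have "(\<Sum>n\<in>F. \<Sum>\<^sub>\<infinity>m. C * r ^ nat \<bar>n - m\<bar> * (cmod (\<phi> m))\<^sup>2)
      = (\<Sum>\<^sub>\<infinity>m. \<Sum>n\<in>F. C * r ^ nat \<bar>n - m\<bar> * (cmod (\<phi> m))\<^sup>2)"
    by (rule infsumI[OF has_sum_finite_sum[OF F summable_row_sq], symmetric])
  also have "\<dots> \<le> (\<Sum>\<^sub>\<infinity>m. total * (cmod (\<phi> m))\<^sup>2)"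
  proof (rule infsum_mono)
    show "(\<lambda>m. \<Sum>n\<in>F. C * r ^ nat \<bar>n - m\<bar> * (cmod (\<phi> m))\<^sup>2) summable_on UNIV"
      by (rule has_sum_imp_summable) (rule has_sum_finite_sum[OF F summable_row_sq])
    show "(\<lambda>m. total * (cmod (\<phi> m))\<^sup>2) summable_on UNIV"
      using \<phi> unfolding square_summable_def by (rule summable_on_cmult_right)
    fix m
    \<comment> \<open>By symmetry of the distance, the column sum over \<open>F\<close> is part of
      the full sum of row \<open>m\<close>.\<close>
    have "(\<Sum>n\<in>F. C * r ^ nat \<bar>n - m\<bar>) = (\<Sum>n\<in>F. C * r ^ nat \<bar>m - n\<bar>)"
      by (simp add: abs_minus_commute)
    also have "\<dots> \<le> total"
      unfolding infsum_row[of m, symmetric] using C r by (intro finite_sum_le_infsum summable_row F) auto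
    finally show "(\<Sum>n\<in>F. C * r ^ nat \<bar>n - m\<bar> * (cmod (\<phi> m))\<^sup>2) \<le> total * (cmod (\<phi> m))\<^sup>2"
      unfolding sum_distrib_right[symmetric] by (rule mult_right_mono) auto
  qed
  also have "\<dots> = total * (\<Sum>\<^sub>\<infinity>m. (cmod (\<phi> m))\<^sup>2)"
    by (rule infsum_cmult_right')
  finally show ?thesis
    using total_nonneg by (simp add: power2_eq_square mult_left_mono mult.assoc)
qed

lemma square_summable_kernel_op: "square_summable (kernel_op G \<phi>)"
  unfolding square_summable_def
  by (rule nonneg_bounded_partial_sums_imp_summable_on[where C = "total\<^sup>2 * (\<Sum>\<^sub>\<infinity>m. (cmod (\<phi> m))\<^sup>2)"])
    (auto intro!: eventually_finite_subsets_at_top_weakI kernel_op_finite_sum_le)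

end

definition ell2_op :: "ell2 \<Rightarrow> ell2" where "ell2_op \<psi> = Abs_ell2 (kernel_op G (Rep_ell2 \<psi>))"

lemma Rep_ell2_op: "Rep_ell2 (ell2_op \<psi>) = kernel_op G (Rep_ell2 \<psi>)"
  unfolding ell2_op_def by (rule Abs_ell2_inverse) (simp add: square_summable_kernel_op square_summable_Rep)

lemma norm_ell2_op: "norm (ell2_op \<psi>) \<le> total * norm \<psi>"
proof (rule power2_le_imp_le)
  have "(norm (ell2_op \<psi>))\<^sup>2 \<le> total\<^sup>2 * (\<Sum>\<^sub>\<infinity>m. (cmod (Rep_ell2 \<psi> m))\<^sup>2)"
    unfolding norm_ell2_sq Rep_ell2_op
    by (rule infsum_le_finite_sums)
      (use square_summable_kernel_op[OF square_summable_Rep] in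
        \<open>auto simp: square_summable_def intro!: kernel_op_finite_sum_le square_summable_Rep\<close>)
  then show "(norm (ell2_op \<psi>))\<^sup>2 \<le> (total * norm \<psi>)\<^sup>2"
    by (simp add: norm_ell2_sq power_mult_distrib)
  show "0 \<le> total * norm \<psi>" using total_nonneg by simp
qed

lemma bounded_clinear_ell2_op: "bounded_clinear ell2_op"
proof -
  note s = summable_kernel[OF square_summable_Rep]
  have C: "ell2_op (scaleC c \<psi>) = scaleC c (ell2_op \<psi>)" for c \<psi>
  proof -
    have "kernel_op G (\<lambda>n. c * Rep_ell2 \<psi> n) n = c * kernel_op G (Rep_ell2 \<psi>) n" for n
      unfolding kernel_op_def
      by (subst infsum_cmult_right'[symmetric]) (simp add: ac_simps)
    then show ?thesis
      by (simp add: Rep_ell2_inject[symmetric] Rep_ell2_op scaleC.rep_eq fun_eq_iff)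
  qed
  have "ell2_op (r *\<^sub>R \<psi>) = r *\<^sub>R ell2_op \<psi>" for r :: real and \<psi>
  proof -
    have "r *\<^sub>R \<phi> = scaleC (complex_of_real r) \<phi>" for \<phi> by transfer simp
    then show ?thesis using C by simp
  qed
  moreover have "ell2_op (\<psi> + \<psi>') = ell2_op \<psi> + ell2_op \<psi>'" for \<psi> \<psi>'
  proof -
    have "kernel_op G (\<lambda>n. Rep_ell2 \<psi> n + Rep_ell2 \<psi>' n) n
        = kernel_op G (Rep_ell2 \<psi>) n + kernel_op G (Rep_ell2 \<psi>') n" for n
      unfolding kernel_op_def by (subst infsum_add[symmetric]) (auto intro: s simp: distrib_left)
    then show ?thesis
      by (simp add: Rep_ell2_inject[symmetric] Rep_ell2_op plus_ell2.rep_eq fun_eq_iff)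
  qed
  ultimately have "bounded_linear ell2_op"
    by (intro bounded_linear_intro[where K = total]) (use norm_ell2_op in \<open>simp_all add: mult.commute\<close>)
  with C show ?thesis by (auto simp: bounded_clinear_def)
qed

end

text \<open>The formal action of H - z, for \<open>W = V - z\<close>. Solutions of the difference
  equation need not be square summable, so it acts on arbitrary sequences instead of
  \<open>ell2\<close>.\<close>

definition jacobi :: "(int \<Rightarrow> complex) \<Rightarrow> (int \<Rightarrow> complex) \<Rightarrow> int \<Rightarrow> complex" where
  "jacobi W x n = x (n + 1) + x (n - 1) + W n * x n"

lemma Rep_schrodinger_minus:
  assumes "bounded (range V)"
  shows "Rep_ell2 (schrodinger V \<psi> - scaleC z \<psi>) = jacobi (\<lambda>n. complex_of_real (V n) - z) (Rep_ell2 \<psi>)"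
  by (simp add: fun_eq_iff minus_ell2.rep_eq scaleC.rep_eq Rep_schrodinger[OF assms] jacobi_def algebra_simps)

section \<open>Two-sided inversion of the difference operator by a symmetric kernel\<close>

context exp_kernel
begin

lemma jacobi_kernel_op:
  assumes \<phi>: "square_summable \<phi>" and G: "\<And>n m. jacobi W (\<lambda>n. G n m) n = (if n = m then 1 else 0)"
  shows "jacobi W (kernel_op G \<phi>) n = \<phi> n"
proof -
  note s = summable_kernel[OF \<phi>]
  have "jacobi W (kernel_op G \<phi>) n
      = (\<Sum>\<^sub>\<infinity>m. G (n + 1) m * \<phi> m + G (n - 1) m * \<phi> m + W n * (G n m * \<phi> m))"
    unfolding jacobi_def kernel_op_def infsum_cmult_right'[symmetric]
    by (subst infsum_add, intro summable_on_add s, intro summable_on_cmult_right s,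
        subst infsum_add, rule s, rule s) simp
  also have "\<dots> = (\<Sum>\<^sub>\<infinity>m. jacobi W (\<lambda>n. G n m) n * \<phi> m)"
    by (rule infsum_cong) (simp add: jacobi_def algebra_simps)
  also have "\<dots> = (\<Sum>\<^sub>\<infinity>m\<in>{n}. \<phi> m)"
    by (rule infsum_cong_neutral) (auto simp: G)
  finally show ?thesis by simp
qed

text \<open>Summation by parts: reindexing moves the shifts from \<phi> to the second argument of
  \<open>G\<close>, symmetry exchanges the arguments, and there the operator produces a delta. The
  bound on \<open>W\<close> keeps \<open>W m * \<phi> m\<close> square summable.\<close>

lemma kernel_op_jacobi:
  assumes \<phi>: "square_summable \<phi>" and W: "\<And>n. cmod (W n) \<le> B"
    and G: "\<And>n m. jacobi W (\<lambda>n. G n m) n = (if n = m then 1 else 0)"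
    and sym: "\<And>n m. G n m = G m n"
  shows "kernel_op G (jacobi W \<phi>) n = \<phi> n"
proof -
  have bij: "bij_betw (\<lambda>m. m + k) UNIV UNIV" for k :: int
    by (rule bij_betw_byWitness[where f' = "\<lambda>m. m - k"]) auto
  have s1: "(\<lambda>m. G n (m - k) * \<phi> m) summable_on UNIV"
    and i1: "(\<Sum>\<^sub>\<infinity>m. G n m * \<phi> (m + k)) = (\<Sum>\<^sub>\<infinity>m. G n (m - k) * \<phi> m)" for k
    using summable_kernel[OF square_summable_shift[OF \<phi>, of k], of n]
      summable_on_reindex_bij_betw[OF bij[of k], of "\<lambda>m. G n (m - k) * \<phi> m"]
      infsum_reindex_bij_betw[OF bij[of k], of "\<lambda>m. G n (m - k) * \<phi> m"] by simp_all
  note s0 = summable_kernel[OF square_summable_shift[OF \<phi>]]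
  have sW: "(\<lambda>m. G n m * (W m * \<phi> m)) summable_on UNIV"
    by (rule summable_kernel) (rule square_summable_mult[OF \<phi> W])
  have "kernel_op G (jacobi W \<phi>) n
     = (\<Sum>\<^sub>\<infinity>m. G n m * \<phi> (m + 1) + G n m * \<phi> (m + (-1)) + G n m * (W m * \<phi> m))"
    unfolding kernel_op_def jacobi_def by (simp add: algebra_simps)
  also have "\<dots> = (\<Sum>\<^sub>\<infinity>m. G n m * \<phi> (m + 1)) + (\<Sum>\<^sub>\<infinity>m. G n m * \<phi> (m + (-1)))
      + (\<Sum>\<^sub>\<infinity>m. G n m * (W m * \<phi> m))"
    by (subst infsum_add, intro summable_on_add s0 sW, rule sW, subst infsum_add, rule s0, rule s0) simp
  also have "\<dots> = (\<Sum>\<^sub>\<infinity>m. G n (m - 1) * \<phi> m + G n (m - (- 1)) * \<phi> m + G n m * (W m * \<phi> m))"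
    unfolding i1
    by (subst infsum_add, intro summable_on_add s1 sW, rule sW, subst infsum_add, rule s1, rule s1) simp
  also have "\<dots> = (\<Sum>\<^sub>\<infinity>m. jacobi W (\<lambda>m. G m n) m * \<phi> m)"
    by (rule infsum_cong) (simp add: jacobi_def algebra_simps sym[of n])
  also have "\<dots> = (\<Sum>\<^sub>\<infinity>m\<in>{n}. \<phi> m)"
    by (rule infsum_cong_neutral) (auto simp: G)
  finally show ?thesis by simp
qed

lemma not_in_spectrum:
  fixes V :: "int \<Rightarrow> real" and z :: complex
  defines "W \<equiv> \<lambda>n. complex_of_real (V n) - z"
  assumes V: "bounded (range V)"
    and G: "\<And>n m. jacobi W (\<lambda>n. G n m) n = (if n = m then 1 else 0)"
    and sym: "\<And>n m. G n m = G m n"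
  shows "z \<notin> spectrum (schrodinger V)"
proof -
  obtain B where B: "\<And>n. \<bar>V n\<bar> \<le> B" using V unfolding bounded_iff by auto
  have W: "cmod (W n) \<le> B + cmod z" for n
    unfolding W_def using norm_triangle_ineq4[of "complex_of_real (V n)" z] B[of n] by simp
  have "ell2_op (schrodinger V \<psi> - scaleC z \<psi>) = \<psi>" for \<psi>
    unfolding Rep_ell2_inject[symmetric] Rep_ell2_op Rep_schrodinger_minus[OF V] W_def[symmetric]
    by (rule ext, rule kernel_op_jacobi[OF square_summable_Rep W G sym])
  moreover have "schrodinger V (ell2_op \<psi>) - scaleC z (ell2_op \<psi>) = \<psi>" for \<psi>
    unfolding Rep_ell2_inject[symmetric] Rep_schrodinger_minus[OF V] Rep_ell2_op W_def[symmetric]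
    by (rule ext, rule jacobi_kernel_op[OF square_summable_Rep G])
  ultimately show ?thesis
    unfolding spectrum_def using bounded_clinear_ell2_op by blast
qed

end

section \<open>Exponential dichotomies and the Green kernel\<close>

definition solves :: "(int \<Rightarrow> complex) \<Rightarrow> (int \<Rightarrow> complex) \<Rightarrow> bool" where
  "solves W x \<longleftrightarrow> (\<forall>n. jacobi W x n = 0)"

text \<open>The order of the entries is that of the column vectors on which
  \<open>transfer_matrix\<close> acts.\<close>

definition phase :: "(int \<Rightarrow> complex) \<Rightarrow> int \<Rightarrow> complex \<times> complex" where
  "phase x n = (x n, x (n - 1))"

lemma norm_phase_ge: "cmod (x n) \<le> norm (phase x n)" "cmod (x (n - 1)) \<le> norm (phase x n)"
  unfolding phase_def by (rule norm_fst_le, rule norm_snd_le)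

text \<open>On phase vectors this is the discrete Wronskian (Casoratian) of two sequences.\<close>

definition det_pair :: "complex \<times> complex \<Rightarrow> complex \<times> complex \<Rightarrow> complex" where
  "det_pair P Q = fst P * snd Q - snd P * fst Q"

section \<open>Solutions of the difference equation and their Wronskian\<close>

lemma solvesD:
  assumes "solves W x"
  shows "x (n + 1) = - x (n - 1) - W n * x n"
proof -
  have "x (n + 1) + x (n - 1) + W n * x n = 0"
    using assms by (simp add: solves_def jacobi_def)
  then show ?thesis by algebra
qed

lemma solves_lincomb:
  assumes "solves W x" "solves W y"
  shows "solves W (\<lambda>n. a * x n + b * y n)"
proof -
  have "jacobi W (\<lambda>n. a * x n + b * y n) n = a * jacobi W x n + b * jacobi W y n" for n
    by (simp add: jacobi_def algebra_simps)
  then show ?thesis using assms by (simp add: solves_def)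
qed

lemma solves_exists: "\<exists>x. solves W x \<and> x 0 = a \<and> x (- 1) = b"
proof -
  \<comment> \<open>\<open>fwd k\<close> is to hold the values at \<open>k\<close> and
    \<open>k - 1\<close>, and \<open>bwd k\<close> those at \<open>- k\<close> and
    \<open>- k - 1\<close>. Both start from the prescribed pair at the sites 0 and -1.\<close>
  define fwd where "fwd = rec_nat (a, b) (\<lambda>k v. (- snd v - W (int k) * fst v, fst v))"
  define bwd where "bwd = rec_nat (a, b) (\<lambda>k v. (snd v, - W (- int k - 1) * snd v - fst v))"
  define x where "x n = (if n \<ge> 0 then fst (fwd (nat n)) else fst (bwd (nat (- n))))" for n :: int
  have 0: "fwd 0 = (a, b)" "bwd 0 = (a, b)" by (simp_all add: fwd_def bwd_def)
  have f: "fwd (Suc k) = (- snd (fwd k) - W (int k) * fst (fwd k), fst (fwd k))" for k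
    by (simp add: fwd_def)
  have b: "bwd (Suc k) = (snd (bwd k), - W (- int k - 1) * snd (bwd k) - fst (bwd k))" for k
    by (simp add: bwd_def)
  have pos: "x (int k) = fst (fwd k)" for k by (simp add: x_def)
  have x_neg: "x (- int k) = fst (bwd k)" for k by (cases "k = 0") (simp_all add: x_def 0)
  have "jacobi W x n = 0" for n
  proof (cases n)
    case (nonneg k)
    show ?thesis
    proof (cases k)
      case 0
      then show ?thesis
        using pos[of 1] pos[of 0] x_neg[of 1] f[of 0] b[of 0] by (simp add: nonneg jacobi_def \<open>fwd 0 = _\<close> \<open>bwd 0 = _\<close>)
    next
      case (Suc j)
      then show ?thesis
        using pos[of j] pos[of "Suc j"] pos[of "Suc (Suc j)"] f[of j] f[of "Suc j"]
        by (simp add: nonneg jacobi_def add.commute)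
    qed
  next
    case (neg k)
    then have n: "n = - int k - 1" by simp
    have "- int (Suc k) = - int k - 1" "- int (Suc (Suc k)) = - int k - 1 - 1" by simp_all
    from x_neg[of "Suc k", unfolded this] x_neg[of "Suc (Suc k)", unfolded this]
    have "x (- int k) = fst (bwd k)" "x (- int k - 1) = snd (bwd k)"
      "x (- int k - 1 - 1) = - W (- int k - 1) * snd (bwd k) - fst (bwd k)"
      by (simp_all only: x_neg b fst_conv snd_conv)
    then show ?thesis
      by (simp add: jacobi_def n)
  qed
  moreover have "x 0 = a" "x (- 1) = b"
    using pos[of 0] x_neg[of 1] b[of 0] by (simp_all add: 0)
  ultimately show ?thesis unfolding solves_def by blast
qed

text \<open>One step of the recursion is a matrix of determinant one: the terms with
  \<open>W\<close> cancel in the antisymmetric expression.\<close>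

lemma det_phase_const:
  assumes "solves W x" "solves W y"
  shows "det_pair (phase x n) (phase y n) = det_pair (phase x 0) (phase y 0)"
proof (induction n rule: int_induct[where k = 0])
  case (step1 i)
  have "det_pair (phase x (i + 1)) (phase y (i + 1)) = det_pair (phase x i) (phase y i)"
    by (simp add: phase_def det_pair_def solvesD[OF assms(1), of i] solvesD[OF assms(2), of i])
      (simp add: algebra_simps)
  with step1 show ?case by simp
next
  case (step2 i)
  have "x i = - x (i - 1 - 1) - W (i - 1) * x (i - 1)" "y i = - y (i - 1 - 1) - W (i - 1) * y (i - 1)"
    using solvesD[OF assms(1), of "i - 1"] solvesD[OF assms(2), of "i - 1"] by simp_all
  then have "det_pair (phase x i) (phase y i) = det_pair (phase x (i - 1)) (phase y (i - 1))"
    by (simp add: phase_def det_pair_def) (simp add: algebra_simps)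
  with step2 show ?case by simp
qed simp

lemma norm_det_pair_le: "cmod (det_pair P Q) \<le> norm P * norm Q"
proof -
  have "cmod (det_pair P Q) \<le> cmod (fst P) * cmod (snd Q) + cmod (snd P) * cmod (fst Q)"
    unfolding det_pair_def using norm_triangle_ineq4 by (metis norm_mult)
  also have "\<dots> = (cmod (fst P), cmod (snd P)) \<bullet> (cmod (snd Q), cmod (fst Q))"
    by simp
  also have "\<dots> \<le> norm (cmod (fst P), cmod (snd P)) * norm (cmod (snd Q), cmod (fst Q))"
    by (rule norm_cauchy_schwarz)
  also have "\<dots> = norm P * norm Q"
    by (cases P; cases Q) (simp add: norm_Pair add.commute)
  finally show ?thesis .
qed

text \<open>Area is base times height: the modulus of \<open>det_pair P Q\<close> is the length of
  \<open>P\<close> times the distance from \<open>Q\<close> to the complex line through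
  \<open>P\<close>, and the hypothesis bounds this distance from below.\<close>

lemma norm_mult_le_det_pair:
  fixes P Q :: "complex \<times> complex"
  assumes "\<And>b. norm Q \<le> K * norm (Q - (b * fst P, b * snd P))"
  shows "norm P * norm Q \<le> K * cmod (det_pair P Q)"
proof (cases "P = 0")
  case False
  obtain p1 p2 where P: "P = (p1, p2)" by (cases P)
  obtain q1 q2 where Q: "Q = (q1, q2)" by (cases Q)
  define N where "N = complex_of_real ((norm P)\<^sup>2)"
  have N: "N = p1 * cnj p1 + p2 * cnj p2"
    unfolding N_def P by (simp add: norm_Pair flip: complex_norm_square)
  have N0: "N \<noteq> 0" using False by (simp add: N_def)
  \<comment> \<open>the orthogonal projection of \<open>Q\<close> onto the line spanned by \<open>P\<close>\<close>
  define b where "b = (q1 * cnj p1 + q2 * cnj p2) / N"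
  have "Q - (b * fst P, b * snd P) = (det_pair P Q * (- cnj p2) / N, det_pair P Q * cnj p1 / N)"
    using N0 by (simp add: P Q b_def det_pair_def field_simps) (simp add: N algebra_simps)
  then have "norm (Q - (b * fst P, b * snd P))
      = norm (det_pair P Q * (- cnj p2) / N, det_pair P Q * cnj p1 / N)"
    by (simp only:)
  also have "\<dots> = sqrt ((cmod (det_pair P Q) / (norm P)\<^sup>2)\<^sup>2 * ((cmod p1)\<^sup>2 + (cmod p2)\<^sup>2))"
    by (simp add: norm_Pair norm_mult norm_divide norm_power N_def power_mult_distrib power_divide algebra_simps add_divide_distrib)
  also have "\<dots> = cmod (det_pair P Q) / (norm P)\<^sup>2 * norm P"
    by (simp add: real_sqrt_mult P norm_Pair)
  also have "\<dots> = cmod (det_pair P Q) / norm P"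
    using False by (simp add: power2_eq_square)
  finally have "norm P * norm (Q - (b * fst P, b * snd P)) = cmod (det_pair P Q)"
    using False by simp
  with mult_left_mono[OF assms[of b] norm_ge_zero[of P]] show ?thesis
    by (simp add: mult.left_commute)
qed (use assms[of 0] in \<open>simp add: det_pair_def zero_prod_def\<close>)

text \<open>A crude growth bound for every solution: each step costs at most a factor
  \<open>B + 2\<close>.\<close>

lemma norm_phase_step:
  assumes "solves W x" "\<And>n. cmod (W n) \<le> B"
  shows "norm (phase x (m + int k)) \<le> (B + 2) ^ k * norm (phase x m)"
proof (induction k)
  case (Suc k)
  let ?n = "m + int k"
  have B: "0 \<le> B" using assms(2)[of 0] norm_ge_zero[of "W 0"] by linarith
  have fst: "cmod (x ?n) \<le> norm (phase x ?n)" and snd: "cmod (x (?n - 1)) \<le> norm (phase x ?n)"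
    by (rule norm_phase_ge)+
  have "norm (phase x (?n + 1)) \<le> cmod (x (?n + 1)) + cmod (x ?n)"
    unfolding phase_def using norm_Pair_le[of "x (?n + 1)" "x ?n"] by simp
  also have "x (?n + 1) = - x (?n - 1) - W ?n * x ?n" by (rule solvesD[OF assms(1)])
  also have "cmod \<dots> \<le> cmod (x (?n - 1)) + cmod (W ?n * x ?n)"
    using norm_triangle_ineq4[of "- x (?n - 1)"] by simp
  also have "cmod (W ?n * x ?n) \<le> B * norm (phase x ?n)"
    unfolding norm_mult by (rule mult_mono[OF assms(2) fst B norm_ge_zero])
  finally have "norm (phase x (?n + 1)) \<le> (B + 2) * norm (phase x ?n)"
    using fst snd by (simp add: algebra_simps)
  also have "\<dots> \<le> (B + 2) * ((B + 2) ^ k * norm (phase x m))"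
    using B by (intro mult_left_mono Suc.IH) auto
  finally show ?case by (simp add: algebra_simps)
qed simp

text \<open>\<open>p\<close> is contracted towards minus infinity, so its estimate bounds the value
  at the left site; \<open>q\<close> is contracted towards plus infinity. The nonzero phases at site
  0 exclude the zero solution.\<close>

definition dichotomy :: "(int \<Rightarrow> complex) \<Rightarrow> (int \<Rightarrow> complex) \<Rightarrow> (int \<Rightarrow> complex) \<Rightarrow> real \<Rightarrow> real \<Rightarrow> bool" where
  "dichotomy W p q C r \<longleftrightarrow> solves W p \<and> solves W q \<and> 0 < C \<and> 0 < r \<and> r < 1 \<and>
     phase p 0 \<noteq> 0 \<and> phase q 0 \<noteq> 0 \<and>
     (\<forall>m k. norm (phase p m) \<le> C * r ^ k * norm (phase p (m + int k))) \<and>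
     (\<forall>m k. norm (phase q (m + int k)) \<le> C * r ^ k * norm (phase q m))"

text \<open>If the direction of \<open>q\<close> came too close to that of \<open>p\<close> at some site, then over a fixed number of
  further steps \<open>q\<close> would have to grow with \<open>p\<close>.\<close>

lemma dichotomy_transversal:
  assumes d: "dichotomy W p q C r" and W: "\<And>n. cmod (W n) \<le> B"
  obtains K where "0 < K"
    "\<And>m. norm (phase p m) * norm (phase q m) \<le> K * cmod (det_pair (phase p 0) (phase q 0))"
proof -
  have sol: "solves W p" "solves W q" and C: "0 < C" and r: "0 < r" "r < 1"
    and pc: "\<And>m k. norm (phase p m) \<le> C * r ^ k * norm (phase p (m + int k))"
    and qc: "\<And>m k. norm (phase q (m + int k)) \<le> C * r ^ k * norm (phase q m)"
    using d unfolding dichotomy_def by blast+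
  have B: "0 \<le> B" using W[of 0] norm_ge_zero[of "W 0"] by linarith
  \<comment> \<open>After \<open>k\<close> steps both contractions gain at least a factor 2.\<close>
  obtain k where k: "r ^ k < 1 / (2 * C)"
    using real_arch_pow_inv[of "1 / (2 * C)" r] C r by auto
  define t where "t = C * r ^ k"
  have t: "0 \<le> t" "t \<le> 1 / 2" using k C r by (simp_all add: t_def field_simps)
  define M where "M = (B + 2) ^ k"
  have M: "0 \<le> M" using B by (simp add: M_def)
  have "norm (phase p m) * norm (phase q m) \<le> (2 + M) * cmod (det_pair (phase p 0) (phase q 0))" for m
  proof -
    \<comment> \<open>The hypothesis of \<open>norm_mult_le_det_pair\<close> at site
      \<open>m\<close>. Over \<open>k\<close> steps to the right \<open>b * p\<close> grows and
      \<open>q\<close> shrinks, so if they nearly agreed at \<open>m\<close>, their difference would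
      have to grow by more than the factor \<open>M\<close>.\<close>
    have "norm (phase q m) \<le> (2 + M) * norm (phase q m - (b * fst (phase p m), b * snd (phase p m)))" for b
    proof -
      define x where "x n = q n - b * p n" for n
      have x: "solves W x"
        using solves_lincomb[OF sol(2,1), of 1 "- b"] by (simp add: x_def[abs_def])
      have px: "phase x n = phase q n - (b * fst (phase p n), b * snd (phase p n))" for n
        by (simp add: phase_def x_def)
      have nb: "norm (b * fst (phase p n), b * snd (phase p n)) = cmod b * norm (phase p n)" for n
        by (simp add: phase_def norm_Pair norm_mult power_mult_distrib
            distrib_left[symmetric] real_sqrt_mult)
      have 1: "norm (phase q m) \<le> norm (phase x m) + cmod b * norm (phase p m)"
        using norm_triangle_ineq[of "phase x m" "(b * fst (phase p m), b * snd (phase p m))"]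
        unfolding nb by (simp add: px)
      have "cmod b * norm (phase p m) \<le> cmod b * (t * norm (phase p (m + int k)))"
        unfolding t_def by (intro mult_left_mono pc) auto
      also have "\<dots> = t * norm (b * fst (phase p (m + int k)), b * snd (phase p (m + int k)))"
        unfolding nb by simp
      also have "\<dots> \<le> t * (norm (phase q (m + int k)) + norm (phase x (m + int k)))"
        using norm_triangle_ineq4[of "phase q (m + int k)" "phase x (m + int k)"] t
        by (intro mult_left_mono) (simp_all add: px)
      also have "\<dots> \<le> t * (t * norm (phase q m) + M * norm (phase x m))"
        unfolding t_def[symmetric] M_def using qc[of m k] norm_phase_step[OF x W, of m k] t
        by (intro mult_left_mono add_mono) (auto simp: t_def)
      also have "\<dots> \<le> 1 / 2 * (1 / 2 * norm (phase q m) + M * norm (phase x m))"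
        using t M by (intro mult_mono add_mono mult_right_mono add_nonneg_nonneg mult_nonneg_nonneg) simp_all
      finally have "cmod b * norm (phase p m) \<le> 1 / 4 * norm (phase q m) + 1 / 2 * (M * norm (phase x m))"
        by (simp only: distrib_left mult.assoc[symmetric])
      moreover have "0 \<le> M * norm (phase x m)" using M by simp
      \<comment> \<open>The quarter of \<open>norm (phase q m)\<close> is absorbed into the left
        side.\<close>
      ultimately have "norm (phase q m) \<le> 2 * norm (phase x m) + M * norm (phase x m)"
        using 1 norm_ge_zero[of "phase x m"] by linarith
      then have "norm (phase q m) \<le> (2 + M) * norm (phase x m)"
        by (simp only: distrib_right)
      then show ?thesis by (simp add: px)
    qed
    from norm_mult_le_det_pair[OF this] show ?thesis
      by (simp only: det_phase_const[OF sol, of m])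
  qed
  moreover have "0 < 2 + M" using M by simp
  ultimately show ?thesis using that by blast
qed

text \<open>Variation of constants: the Green kernel takes \<open>p\<close> at the smaller and
  \<open>q\<close> at the larger index. Division by the Wronskian turns the jump on the diagonal
  into 1.\<close>

lemma dichotomy_not_in_spectrum:
  fixes V :: "int \<Rightarrow> real" and z :: complex
  defines "W \<equiv> \<lambda>n. complex_of_real (V n) - z"
  assumes V: "bounded (range V)" and d: "dichotomy W p q C r"
  shows "z \<notin> spectrum (schrodinger V)"
proof -
  obtain B where B: "\<And>n. \<bar>V n\<bar> \<le> B" using V unfolding bounded_iff by auto
  have W: "cmod (W n) \<le> B + cmod z" for n
    unfolding W_def using norm_triangle_ineq4[of "complex_of_real (V n)" z] B[of n] by simp
  define w where "w = det_pair (phase p 0) (phase q 0)"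
  obtain K where K: "0 < K" "\<And>m. norm (phase p m) * norm (phase q m) \<le> K * cmod w"
    using dichotomy_transversal[OF d W] unfolding w_def by metis
  have sol: "solves W p" "solves W q" and C: "0 < C" and r: "0 < r" "r < 1"
    and nz: "phase p 0 \<noteq> 0" "phase q 0 \<noteq> 0"
    and qc: "\<And>m k. norm (phase q (m + int k)) \<le> C * r ^ k * norm (phase q m)"
    using d unfolding dichotomy_def by blast+
  \<comment> \<open>Transversality at site 0 rules out a vanishing Wronskian, since the left side of
    the estimate is positive there.\<close>
  have "0 < norm (phase p 0) * norm (phase q 0)" using nz by simp
  then have w: "w \<noteq> 0" using K(2)[of 0] by auto
  define G where "G n m = - (p (min n m) * q (max n m)) / w" for n m
  \<comment> \<open>No uniform bound on \<open>p\<close> or \<open>q\<close> alone is at hand. The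
    contraction carries \<open>q\<close> back from \<open>n\<close> to \<open>m\<close>, where
    transversality bounds the product of the two phases.\<close>
  have le: "cmod (p m * q n) \<le> C * K * cmod w * r ^ nat (n - m)" if "m \<le> n" for m n
  proof -
    have "n = m + int (nat (n - m))" using that by simp
    then have "norm (phase q n) \<le> C * r ^ nat (n - m) * norm (phase q m)"
      using qc[of m "nat (n - m)"] by simp
    then have "norm (phase p m) * norm (phase q n) \<le> norm (phase p m) * (C * r ^ nat (n - m) * norm (phase q m))"
      by (rule mult_left_mono) simp
    also have "\<dots> = C * r ^ nat (n - m) * (norm (phase p m) * norm (phase q m))" by simp
    also have "\<dots> \<le> C * r ^ nat (n - m) * (K * cmod w)"
      using C r by (intro mult_left_mono K) auto
    finally have "norm (phase p m) * norm (phase q n) \<le> C * r ^ nat (n - m) * (K * cmod w)" .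
    moreover have "cmod (p m) * cmod (q n) \<le> norm (phase p m) * norm (phase q n)"
      by (intro mult_mono norm_phase_ge) simp_all
    ultimately show ?thesis by (simp add: norm_mult algebra_simps)
  qed
  interpret exp_kernel G "C * K" r
  proof
    fix n m
    have "cmod (p (min n m) * q (max n m)) \<le> C * K * cmod w * r ^ nat (max n m - min n m)"
      by (rule le) simp
    also have "max n m - min n m = \<bar>n - m\<bar>" by (simp add: max_def min_def)
    finally show "cmod (G n m) \<le> C * K * r ^ nat \<bar>n - m\<bar>"
      using w by (simp add: G_def norm_divide field_simps)
  qed (use C K r in auto)
  have "jacobi W (\<lambda>n. G n m) n = (if n = m then 1 else 0)" for n m
  proof -
    consider "n < m" | "n > m" | "n = m" by linarith
    then show ?thesis
    proof cases
      case 1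
      then have "jacobi W (\<lambda>n. G n m) n = - q m / w * jacobi W p n"
        by (simp add: jacobi_def G_def min_def max_def add_divide_distrib algebra_simps)
      then show ?thesis using 1 sol by (simp add: solves_def)
    next
      case 2
      then have "min (n - 1) m = m" "max (n - 1) m = n - 1" "min (n + 1) m = m" "max (n + 1) m = n + 1"
        "min n m = m" "max n m = n" by auto
      then have "jacobi W (\<lambda>n. G n m) n = - p m / w * jacobi W q n"
        by (simp add: jacobi_def G_def add_divide_distrib algebra_simps)
      then show ?thesis using 2 sol by (simp add: solves_def)
    next
      case 3
      \<comment> \<open>On the diagonal the recursion for \<open>q\<close> reduces the expression to
        the Wronskian at \<open>n\<close>, which equals \<open>w\<close>.\<close>
      have "p n * q (n - 1) - p (n - 1) * q n = w"
        using det_phase_const[OF sol, of n] by (simp add: w_def det_pair_def phase_def)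
      moreover have "q (n + 1) + W n * q n = - q (n - 1)"
        using solvesD[OF sol(2), of n] by simp
      moreover have "jacobi W (\<lambda>n. G n m) n = - (p n * (q (n + 1) + W n * q n) + p (n - 1) * q n) / w"
        using 3 by (simp add: jacobi_def G_def min_def max_def add_divide_distrib diff_divide_distrib algebra_simps)
      ultimately show ?thesis
        using 3 w by simp
    qed
  qed
  moreover have "G n m = G m n" for n m by (simp add: G_def min.commute max.commute)
  ultimately show ?thesis
    unfolding W_def by (intro not_in_spectrum[OF V]) auto
qed

section \<open>Lower bounds and decaying solutions\<close>

text \<open>Since \<open>y\<close> vanishes at \<open>a\<close> and \<open>b\<close> themselves,
  \<open>jacobi W y\<close> is supported in \<open>{a..b}\<close>, so both finite sums are full
  squared norms. For fixed \<open>y\<close> only finitely many values of \<open>W\<close> enter,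
  which allows passing to orbit closures.\<close>

definition bounded_below :: "real \<Rightarrow> (int \<Rightarrow> complex) \<Rightarrow> bool" where
  "bounded_below c W \<longleftrightarrow> (\<forall>a b y. (\<forall>n. n \<le> a \<or> b \<le> n \<longrightarrow> y n = 0) \<longrightarrow>
     c * (\<Sum>n\<in>{a..b}. (cmod (y n))\<^sup>2) \<le> (\<Sum>n\<in>{a..b}. (cmod (jacobi W y n))\<^sup>2))"

lemma bounded_belowD:
  assumes "bounded_below c W" "\<And>n. n \<le> a \<Longrightarrow> y n = 0" "\<And>n. b \<le> n \<Longrightarrow> y n = 0"
  shows "c * (\<Sum>n\<in>{a..b}. (cmod (y n))\<^sup>2) \<le> (\<Sum>n\<in>{a..b}. (cmod (jacobi W y n))\<^sup>2)"
  using assms unfolding bounded_below_def by blast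

lemma norm_phase_sq: "(norm (phase x n))\<^sup>2 = (cmod (x n))\<^sup>2 + (cmod (x (n - 1)))\<^sup>2"
  by (simp add: phase_def norm_Pair)

text \<open>The bound is tested on the truncation of a solution to an interval.\<close>

lemma bounded_below_solution:
  assumes bb: "bounded_below c W" and x: "solves W x" and "M < N"
  shows "c * (\<Sum>n\<in>{M..N}. (cmod (x n))\<^sup>2) \<le> (norm (phase x M))\<^sup>2 + (norm (phase x (N + 1)))\<^sup>2"
proof -
  define y where "y n = (if M \<le> n \<and> n \<le> N then x n else 0)" for n
  have "(\<Sum>n\<in>{M..N}. (cmod (x n))\<^sup>2) = (\<Sum>n\<in>{M-1..N+1}. (cmod (y n))\<^sup>2)"
    by (rule sum.mono_neutral_cong_left) (auto simp: y_def)
  then have "c * (\<Sum>n\<in>{M..N}. (cmod (x n))\<^sup>2) \<le> (\<Sum>n\<in>{M-1..N+1}. (cmod (jacobi W y n))\<^sup>2)"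
    using bounded_belowD[OF bb, of "M - 1" y "N + 1"] by (simp add: y_def)
  \<comment> \<open>Truncation leaves an error only at the two sites next to each cut.
    \<open>M < N\<close> keeps these four sites distinct, and the four terms add up to the squared
    phase norms at both ends.\<close>
  also have "\<dots> = (\<Sum>n\<in>{M-1..N+1}. (if n = M - 1 then (cmod (x M))\<^sup>2 else 0)
      + (if n = M then (cmod (x (M - 1)))\<^sup>2 else 0)
      + (if n = N then (cmod (x (N + 1)))\<^sup>2 else 0)
      + (if n = N + 1 then (cmod (x N))\<^sup>2 else 0))"
  proof (rule sum.cong)
    fix n assume n: "n \<in> {M-1..N+1}"
    have jx: "x (n + 1) + x (n - 1) + W n * x n = 0"
      using x by (simp add: solves_def jacobi_def)
    have jx2: "x (n + 1) + W n * x n = - x (n - 1)" and jx4: "x (n - 1) + W n * x n = - x (n + 1)"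
      using jx by algebra+
    consider "n = M - 1" | "n = M" | "M < n" "n < N" | "n = N" | "n = N + 1"
      using n by fastforce
    then show "(cmod (jacobi W y n))\<^sup>2 = (if n = M - 1 then (cmod (x M))\<^sup>2 else 0)
      + (if n = M then (cmod (x (M - 1)))\<^sup>2 else 0)
      + (if n = N then (cmod (x (N + 1)))\<^sup>2 else 0)
      + (if n = N + 1 then (cmod (x N))\<^sup>2 else 0)"
    proof cases
      case 2
      then have "jacobi W y n = - x (n - 1)"
        using jx2 \<open>M < N\<close> by (simp add: jacobi_def y_def)
      then show ?thesis using 2 \<open>M < N\<close> by simp
    next
      case 4
      then have "jacobi W y n = - x (n + 1)"
        using jx4 \<open>M < N\<close> by (simp add: jacobi_def y_def)
      then show ?thesis using 4 \<open>M < N\<close> by simp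
    next
      case 3
      then have "jacobi W y n = 0"
        using jx by (simp add: jacobi_def y_def)
      then show ?thesis using 3 by simp
    qed (use \<open>M < N\<close> in \<open>simp_all add: jacobi_def y_def\<close>)
  qed simp
  also have "\<dots> = (norm (phase x M))\<^sup>2 + (norm (phase x (N + 1)))\<^sup>2"
    using \<open>M < N\<close> by (simp add: sum.distrib sum.delta norm_phase_sq)
  finally show ?thesis .
qed

text \<open>The tails satisfy \<open>S (Suc m) = S m - a m\<close>, and
  \<open>S m \<le> K * a m\<close> turns this into a contraction by the factor
  \<open>1 - 1 / K\<close>.\<close>

lemma tail_sums_imp_exponential_decay:
  fixes a :: "nat \<Rightarrow> real"
  assumes a: "\<And>k. 0 \<le> a k" and K: "1 < K"
    and tail: "\<And>m L. (\<Sum>k<L. a (m + k)) \<le> K * a m"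
  shows "a k \<le> K * (1 - 1 / K) ^ k * a 0"
proof -
  have sum: "summable (\<lambda>k. a (m + k))" for m
    by (rule summableI_nonneg_bounded[OF a tail])
  define S where "S m = (\<Sum>k. a (m + k))" for m
  have S_le: "S m \<le> K * a m" for m
    unfolding S_def by (rule suminf_le_const[OF sum tail])
  have "S k \<le> (1 - 1 / K) ^ k * S 0"
  proof (induction k)
    case (Suc k)
    have "S k = a k + S (Suc k)"
      using suminf_split_head[OF sum[of k]] by (simp add: S_def)
    moreover have "S k / K \<le> a k" using S_le[of k] K by (simp add: field_simps)
    ultimately have "S (Suc k) \<le> (1 - 1 / K) * S k" by (simp add: left_diff_distrib)
    also have "\<dots> \<le> (1 - 1 / K) * ((1 - 1 / K) ^ k * S 0)"
      using K by (intro mult_left_mono Suc.IH) simp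
    finally show ?case by simp
  qed simp
  moreover have "a k \<le> S k"
    using sum_le_suminf[OF sum[of k], of "{0}"] a by (simp add: S_def)
  moreover have "(1 - 1 / K) ^ k * S 0 \<le> (1 - 1 / K) ^ k * (K * a 0)"
    using K by (intro mult_left_mono S_le) simp
  ultimately show ?thesis by (simp add: mult.commute mult.left_commute)
qed

text \<open>Here and in \<open>decay_rate\<close>: the square roots of \<open>K\<close> and
  \<open>1 - 1 / K\<close> for \<open>K = 2 / c + 1\<close>, because
  \<open>tail_sums_imp_exponential_decay\<close> is applied to squared phase norms. Both depend on
  \<open>c\<close> alone, hence not on \<omega>.\<close>

definition decay_const :: "real \<Rightarrow> real" where "decay_const c = sqrt (2 / c + 1)"

definition decay_rate :: "real \<Rightarrow> real" where "decay_rate c = sqrt (1 - 1 / (2 / c + 1))"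

lemma decay_const_rate:
  assumes "0 < c"
  shows "0 < decay_const c" "0 < decay_rate c" "decay_rate c < 1"
  using assms by (simp_all add: decay_const_def decay_rate_def add_pos_pos)

lemma bounded_below_decay:
  assumes bb: "bounded_below c W" and c: "0 < c" and x: "solves W x"
    and lim: "(\<lambda>k. phase x (int k)) \<longlonglongrightarrow> 0"
  shows "norm (phase x (m + int k)) \<le> decay_const c * decay_rate c ^ k * norm (phase x m)"
proof -
  define K where "K = 2 / c + 1"
  have K: "1 < K" using c by (simp add: K_def)
  \<comment> \<open>The right end of the interval in \<open>bounded_below_solution\<close> is sent
    to infinity, where its boundary term tends to 0 by \<open>lim\<close>.\<close>
  have tail0: "c * (\<Sum>k<L. (cmod (x (m + int k)))\<^sup>2) \<le> (norm (phase x m))\<^sup>2" for m L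
  proof (rule LIMSEQ_le_const)
    have "(\<lambda>k. (norm (phase x m))\<^sup>2 + (norm (phase x (int k)))\<^sup>2) \<longlonglongrightarrow> (norm (phase x m))\<^sup>2 + (norm (0 :: complex \<times> complex))\<^sup>2"
      by (intro tendsto_intros lim)
    then show "(\<lambda>k. (norm (phase x m))\<^sup>2 + (norm (phase x (int k)))\<^sup>2) \<longlonglongrightarrow> (norm (phase x m))\<^sup>2"
      by simp
    show "\<exists>N. \<forall>k\<ge>N. c * (\<Sum>k<L. (cmod (x (m + int k)))\<^sup>2) \<le> (norm (phase x m))\<^sup>2 + (norm (phase x (int k)))\<^sup>2"
    proof (intro exI allI impI)
      fix k assume "nat (\<bar>m\<bar> + int L + 3) \<le> k"
      then have k: "m < int k - 1" "m + int L \<le> int k - 1" by linarith+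
      have "(\<Sum>k<L. (cmod (x (m + int k)))\<^sup>2) = (\<Sum>n\<in>{m..<m + int L}. (cmod (x n))\<^sup>2)"
        by (rule sum.reindex_bij_witness[of _ "\<lambda>n. nat (n - m)" "\<lambda>k. m + int k"]) auto
      also have "\<dots> \<le> (\<Sum>n\<in>{m..int k - 1}. (cmod (x n))\<^sup>2)"
        using k by (intro sum_mono2) auto
      finally have "c * (\<Sum>k<L. (cmod (x (m + int k)))\<^sup>2) \<le> c * (\<Sum>n\<in>{m..int k - 1}. (cmod (x n))\<^sup>2)"
        using c by simp
      also have "\<dots> \<le> (norm (phase x m))\<^sup>2 + (norm (phase x (int k)))\<^sup>2"
        using bounded_below_solution[OF bb x k(1)] by simp
      finally show "c * (\<Sum>k<L. (cmod (x (m + int k)))\<^sup>2) \<le> (norm (phase x m))\<^sup>2 + (norm (phase x (int k)))\<^sup>2" .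
    qed
  qed
  have tail: "(\<Sum>k<L. (norm (phase x (m + int k)))\<^sup>2) \<le> K * (norm (phase x m))\<^sup>2" for m L
  proof -
    \<comment> \<open>Every value of \<open>x\<close> occurs in two consecutive phases, except at
      the ends. This gives the 2 in \<open>2 / c\<close>, and the leftover \<open>x (m - 1)\<close>
      gives the summand 1 in \<open>K\<close>.\<close>
    have "(\<Sum>k<L. (norm (phase x (m + int k)))\<^sup>2) + (cmod (x (m + int L - 1)))\<^sup>2
        = (cmod (x (m - 1)))\<^sup>2 + 2 * (\<Sum>k<L. (cmod (x (m + int k)))\<^sup>2)"
      by (induction L) (simp_all add: norm_phase_sq)
    moreover have "(cmod (x (m - 1)))\<^sup>2 \<le> (norm (phase x m))\<^sup>2"
      by (simp add: norm_phase_sq)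
    moreover have "2 * (\<Sum>k<L. (cmod (x (m + int k)))\<^sup>2) \<le> 2 / c * (norm (phase x m))\<^sup>2"
      using tail0[where L = L] c by (simp add: field_simps)
    moreover have "K * (norm (phase x m))\<^sup>2 = 2 / c * (norm (phase x m))\<^sup>2 + (norm (phase x m))\<^sup>2"
      by (simp add: K_def algebra_simps)
    ultimately show ?thesis using zero_le_power2[of "cmod (x (m + int L - 1))"] by linarith
  qed
  have "(norm (phase x (m + int k)))\<^sup>2 \<le> K * (1 - 1 / K) ^ k * (norm (phase x m))\<^sup>2"
    using tail_sums_imp_exponential_decay[of "\<lambda>k. (norm (phase x (m + int k)))\<^sup>2" K k, OF _ K]
      tail[of "m + int _"] by (simp add: add.assoc)
  then have "sqrt ((norm (phase x (m + int k)))\<^sup>2) \<le> sqrt (K * (1 - 1 / K) ^ k * (norm (phase x m))\<^sup>2)"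
    by (rule real_sqrt_le_mono)
  then show ?thesis
    by (simp add: real_sqrt_mult real_sqrt_power decay_const_def decay_rate_def K_def)
qed

text \<open>Compactness: for every \<open>N\<close> some unit initial vector has controlled mass up
  to \<open>N + 1\<close>. These conditions are closed and nested, so one vector meets them all, and
  its solution is square summable to the right.\<close>

lemma bounded_below_decaying_solution:
  assumes bb: "bounded_below c W" and c: "0 < c"
  obtains x where "solves W x" "phase x 0 \<noteq> 0" "(\<lambda>k. phase x (int k)) \<longlonglongrightarrow> 0"
proof -
  obtain f where f: "solves W f" "f 0 = 1" "f (- 1) = 0" using solves_exists by metis
  obtain g where g: "solves W g" "g 0 = 0" "g (- 1) = 1" using solves_exists by metis
  define X where "X v n = fst v * f n + snd v * g n" for v n
  have X: "solves W (X v)" for v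
    unfolding X_def[abs_def] by (rule solves_lincomb[OF f(1) g(1)])
  have X0: "phase (X v) 0 = v" for v
    by (simp add: phase_def X_def f g)
  \<comment> \<open>The bound 2 leaves room for a contribution of at most 1 from each end of the
    interval in \<open>bounded_below_solution\<close>.\<close>
  define F where "F N = {v \<in> sphere 0 1. c * (\<Sum>n\<in>{0..int N + 1}. (cmod (X v n))\<^sup>2) \<le> 2}" for N
  have "\<Inter> (range F) \<noteq> {}"
  proof (rule compact_nest)
    fix N
    have "closed {v. c * (\<Sum>n\<in>{0..int N + 1}. (cmod (X v n))\<^sup>2) \<le> 2}"
      unfolding X_def by (intro closed_Collect_le continuous_intros)
    then have "compact (sphere 0 1 \<inter> {v. c * (\<Sum>n\<in>{0..int N + 1}. (cmod (X v n))\<^sup>2) \<le> 2})"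
      by (intro compact_Int_closed compact_sphere)
    then show "compact (F N)" unfolding F_def by (simp add: Int_def)
    define t where "t = int N + 2"
    \<comment> \<open>initial data of the two solutions whose phase vector at \<open>t\<close> is a standard basis vector\<close>
    define v1 where "v1 = (g (t - 1), - f (t - 1))"
    define v2 where "v2 = (- g t, f t)"
    have det: "f t * g (t - 1) - f (t - 1) * g t = 1"
      using det_phase_const[OF f(1) g(1), of t] by (simp add: phase_def det_pair_def f g)
    have "phase (X v1) t = (1, 0)" "phase (X v2) t = (0, 1)"
      using det by (simp_all add: phase_def X_def v1_def v2_def algebra_simps)
    then have n1: "norm (phase (X v1) t) = 1" "norm (phase (X v2) t) = 1"
      by (simp_all add: norm_Pair)
    \<comment> \<open>As the determinant is 1, one of \<open>v1\<close>, \<open>v2\<close> has norm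
      at least 1. Normalizing it gives initial data of norm 1 whose phase at \<open>t\<close> has
      norm at most 1.\<close>
    have "1 = cmod (det_pair v1 v2)"
      using det by (simp add: det_pair_def v1_def v2_def algebra_simps)
    then have "1 \<le> norm v1 * norm v2" using norm_det_pair_le[of v1 v2] by simp
    then have "1 \<le> norm v1 \<or> 1 \<le> norm v2"
      using mult_strict_mono[of "norm v1" 1 "norm v2" 1] by (smt (verit) norm_ge_zero)
    then obtain v where v: "1 \<le> norm v" "norm (phase (X v) t) = 1" using n1 by blast
    define s where "s = 1 / norm v"
    have s: "0 < s" "s \<le> 1" using v(1) less_le_trans[OF zero_less_one v(1)] by (simp_all add: s_def)
    have "X (s *\<^sub>R v) n = s *\<^sub>R X v n" for n
      by (simp add: X_def algebra_simps)
    then have ph: "phase (X (s *\<^sub>R v)) n = s *\<^sub>R phase (X v) n" for n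
      by (simp add: phase_def)
    have "c * (\<Sum>n\<in>{0..int N + 1}. (cmod (X (s *\<^sub>R v) n))\<^sup>2)
        \<le> (norm (phase (X (s *\<^sub>R v)) 0))\<^sup>2 + (norm (phase (X (s *\<^sub>R v)) (int N + 1 + 1)))\<^sup>2"
      by (rule bounded_below_solution[OF bb X]) simp
    also have "int N + 1 + 1 = t" by (simp add: t_def)
    also have "(norm (phase (X (s *\<^sub>R v)) 0))\<^sup>2 + (norm (phase (X (s *\<^sub>R v)) t))\<^sup>2 = 1 + s\<^sup>2"
      using v s unfolding ph X0 by (simp add: s_def)
    also have "\<dots> \<le> 2" using s power_le_one[of s 2] by simp
    finally have "s *\<^sub>R v \<in> F N"
      using less_le_trans[OF zero_less_one v(1)] by (simp add: F_def s_def)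
    then show "F N \<noteq> {}" by blast
  next
    fix m n :: nat assume "m \<le> n"
    then have "(\<Sum>n\<in>{0..int m + 1}. (cmod (X v n))\<^sup>2) \<le> (\<Sum>n\<in>{0..int n + 1}. (cmod (X v n))\<^sup>2)" for v
      by (intro sum_mono2) auto
    then have "c * (\<Sum>n\<in>{0..int m + 1}. (cmod (X v n))\<^sup>2) \<le> c * (\<Sum>n\<in>{0..int n + 1}. (cmod (X v n))\<^sup>2)" for v
      using c by simp
    then show "F n \<subseteq> F m" unfolding F_def by (auto intro: order_trans)
  qed
  then obtain v where "\<And>N. v \<in> F N" by blast
  then have v: "norm v = 1" "\<And>N. c * (\<Sum>n\<in>{0..int N + 1}. (cmod (X v n))\<^sup>2) \<le> 2"
    by (auto simp: F_def)
  have "summable (\<lambda>k. (cmod (X v (int k)))\<^sup>2)"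
  proof (rule summableI_nonneg_bounded)
    fix N
    have "(\<Sum>k<N. (cmod (X v (int k)))\<^sup>2) = (\<Sum>n\<in>{0..<int N}. (cmod (X v n))\<^sup>2)"
      by (rule sum.reindex_bij_witness[of _ nat int]) auto
    also have "\<dots> \<le> (\<Sum>n\<in>{0..int N + 1}. (cmod (X v n))\<^sup>2)"
      by (intro sum_mono2) auto
    also have "\<dots> \<le> 2 / c" using v(2)[of N] c by (simp add: field_simps)
    finally show "(\<Sum>k<N. (cmod (X v (int k)))\<^sup>2) \<le> 2 / c" .
  qed simp
  then have "(\<lambda>k. (cmod (X v (int k)))\<^sup>2) \<longlonglongrightarrow> 0" by (rule summable_LIMSEQ_zero)
  from tendsto_real_sqrt[OF this] have lim: "(\<lambda>k. X v (int k)) \<longlonglongrightarrow> 0"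
    by (simp add: tendsto_norm_zero_iff)
  have "(\<lambda>k. X v (int (Suc k) - 1)) \<longlonglongrightarrow> 0" using lim by simp
  then have "(\<lambda>k. X v (int k - 1)) \<longlonglongrightarrow> 0" by (rule LIMSEQ_imp_Suc)
  from tendsto_Pair[OF lim this] have "(\<lambda>k. phase (X v) (int k)) \<longlonglongrightarrow> 0"
    by (simp add: phase_def zero_prod_def)
  moreover have "phase (X v) 0 \<noteq> 0" using v(1) X0 by auto
  ultimately show ?thesis using that X by blast
qed

text \<open>The mirror at -1/2 swaps the sites 0 and -1, so the phase at \<open>n\<close> becomes
  the phase at \<open>- n\<close> with its entries exchanged. Statements at minus infinity then
  follow from those at plus infinity.\<close>

definition reflect :: "(int \<Rightarrow> complex) \<Rightarrow> int \<Rightarrow> complex" where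
  "reflect x n = x (- 1 - n)"

lemma reflect_reflect [simp]: "reflect (reflect x) = x"
  by (simp add: reflect_def fun_eq_iff)

lemma jacobi_reflect: "jacobi (reflect W) (reflect x) n = jacobi W x (- 1 - n)"
  by (simp add: jacobi_def reflect_def add.commute)

lemma solves_reflect: "solves W x \<Longrightarrow> solves (reflect W) (reflect x)"
  by (simp add: solves_def jacobi_reflect)

lemma norm_phase_reflect: "norm (phase (reflect x) n) = norm (phase x (- n))"
proof -
  have e: "- 1 - n = - n - 1" "- 1 - (n - 1) = - n" by simp_all
  show ?thesis unfolding phase_def reflect_def e norm_Pair by (simp only: add.commute)
qed

lemma bounded_below_reflect:
  assumes "bounded_below c W"
  shows "bounded_below c (reflect W)"
  unfolding bounded_below_def
proof (intro allI impI)
  fix a b :: int and y assume y: "\<forall>n. n \<le> a \<or> b \<le> n \<longrightarrow> y n = (0::complex)"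
  have *: "(\<Sum>n\<in>{a..b}. h n) = (\<Sum>n\<in>{- 1 - b..- 1 - a}. h (- 1 - n))" for h :: "int \<Rightarrow> real"
    by (rule sum.reindex_bij_witness[of _ "\<lambda>n. - 1 - n" "\<lambda>n. - 1 - n"]) auto
  show "c * (\<Sum>n\<in>{a..b}. (cmod (y n))\<^sup>2) \<le> (\<Sum>n\<in>{a..b}. (cmod (jacobi (reflect W) y n))\<^sup>2)"
    using bounded_belowD[OF assms, of "- 1 - b" "reflect y" "- 1 - a"] y
      jacobi_reflect[of W "reflect y"]
    by (simp add: *) (simp add: reflect_def)
qed

lemma bounded_below_decay_backward:
  assumes bb: "bounded_below c W" and c: "0 < c" and x: "solves W x"
    and lim: "(\<lambda>k. phase x (- int k)) \<longlonglongrightarrow> 0"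
  shows "norm (phase x m) \<le> decay_const c * decay_rate c ^ k * norm (phase x (m + int k))"
proof -
  have "(\<lambda>k. norm (phase (reflect x) (int k))) \<longlonglongrightarrow> 0"
    using tendsto_norm_zero[OF lim] by (simp add: norm_phase_reflect)
  then have "(\<lambda>k. phase (reflect x) (int k)) \<longlonglongrightarrow> 0"
    by (rule tendsto_norm_zero_cancel)
  from bounded_below_decay[OF bounded_below_reflect[OF bb] c solves_reflect[OF x] this, of "- (m + int k)" k]
  show ?thesis by (simp add: norm_phase_reflect add.commute)
qed

lemma bounded_below_decaying_solution_backward:
  assumes bb: "bounded_below c W" and c: "0 < c"
  obtains x where "solves W x" "phase x 0 \<noteq> 0" "(\<lambda>k. phase x (- int k)) \<longlonglongrightarrow> 0"
proof -
  obtain x where x: "solves (reflect W) x" "phase x 0 \<noteq> 0" "(\<lambda>k. phase x (int k)) \<longlonglongrightarrow> 0"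
    using bounded_below_decaying_solution[OF bounded_below_reflect[OF bb] c] .
  have "solves W (reflect x)" using solves_reflect[OF x(1)] by simp
  moreover have "phase (reflect x) 0 \<noteq> 0"
    using x(2) norm_phase_reflect[of x 0] by (metis minus_zero norm_eq_zero)
  moreover have "(\<lambda>k. norm (phase (reflect x) (- int k))) \<longlonglongrightarrow> 0"
    using tendsto_norm_zero[OF x(3)] by (simp add: norm_phase_reflect)
  then have "(\<lambda>k. phase (reflect x) (- int k)) \<longlonglongrightarrow> 0"
    by (rule tendsto_norm_zero_cancel)
  ultimately show ?thesis using that by blast
qed

lemma bounded_below_dichotomy:
  assumes bb: "bounded_below c W" and c: "0 < c"
  obtains p q where "dichotomy W p q (decay_const c) (decay_rate c)"
proof -
  obtain p where p: "solves W p" "phase p 0 \<noteq> 0" "(\<lambda>k. phase p (- int k)) \<longlonglongrightarrow> 0"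
    using bounded_below_decaying_solution_backward[OF bb c] .
  obtain q where q: "solves W q" "phase q 0 \<noteq> 0" "(\<lambda>k. phase q (int k)) \<longlonglongrightarrow> 0"
    using bounded_below_decaying_solution[OF bb c] .
  have "dichotomy W p q (decay_const c) (decay_rate c)"
    using p q decay_const_rate[OF c] bounded_below_decay[OF bb c q(1,3)]
      bounded_below_decay_backward[OF bb c p(1,3)]
    by (simp add: dichotomy_def)
  then show ?thesis using that by blast
qed

section \<open>Dynamically defined potentials\<close>

text \<open>If \<open>K\<close> bounds the norm of the resolvent, H - z shrinks no vector by more
  than the factor \<open>K\<close>; squaring gives \<open>c = 1 / K\<^sup>2\<close>.\<close>

lemma not_in_spectrum_bounded_below:
  fixes V :: "int \<Rightarrow> real" and z :: complex
  assumes V: "bounded (range V)" and z: "z \<notin> spectrum (schrodinger V)"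
  obtains c where "0 < c" "bounded_below c (\<lambda>n. complex_of_real (V n) - z)"
proof -
  let ?W = "\<lambda>n. complex_of_real (V n) - z"
  obtain R where R: "bounded_clinear R" "\<And>\<psi>. R (schrodinger V \<psi> - scaleC z \<psi>) = \<psi>"
    using z unfolding spectrum_def by blast
  obtain K where K: "0 < K" "\<And>\<psi>. norm (R \<psi>) \<le> norm \<psi> * K"
    using R(1) bounded_linear.pos_bounded unfolding bounded_clinear_def by blast
  have "bounded_below (1 / K\<^sup>2) ?W"
    unfolding bounded_below_def
  proof (intro allI impI)
    fix a b :: int and y :: "int \<Rightarrow> complex"
    assume y: "\<forall>n. n \<le> a \<or> b \<le> n \<longrightarrow> y n = 0"
    have sum: "(\<Sum>\<^sub>\<infinity>n. (cmod (x n))\<^sup>2) = (\<Sum>n\<in>{a..b}. (cmod (x n))\<^sup>2)"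
      if "\<And>n. n \<notin> {a..b} \<Longrightarrow> x n = 0" for x :: "int \<Rightarrow> complex"
      using infsum_cong_neutral[of "{a..b}" UNIV "\<lambda>n. (cmod (x n))\<^sup>2" "\<lambda>n. (cmod (x n))\<^sup>2"] that by simp
    have "(\<lambda>n. (cmod (y n))\<^sup>2) summable_on {a..b} \<longleftrightarrow> (\<lambda>n. (cmod (y n))\<^sup>2) summable_on UNIV"
      by (rule summable_on_cong_neutral) (use y in auto)
    then have "square_summable y" by (simp add: square_summable_def)
    then have Rep: "Rep_ell2 (Abs_ell2 y) = y" by (simp add: Abs_ell2_inverse)
    have "(norm (Abs_ell2 y))\<^sup>2 \<le> (norm (schrodinger V (Abs_ell2 y) - scaleC z (Abs_ell2 y)) * K)\<^sup>2"
      using K(2)[of "schrodinger V (Abs_ell2 y) - scaleC z (Abs_ell2 y)"] R(2)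
      by (intro power_mono) simp_all
    moreover have "(norm (Abs_ell2 y))\<^sup>2 = (\<Sum>n\<in>{a..b}. (cmod (y n))\<^sup>2)"
      unfolding norm_ell2_sq Rep using y by (intro sum) auto
    moreover have "(norm (schrodinger V (Abs_ell2 y) - scaleC z (Abs_ell2 y)))\<^sup>2
        = (\<Sum>n\<in>{a..b}. (cmod (jacobi ?W y n))\<^sup>2)"
      unfolding norm_ell2_sq Rep_schrodinger_minus[OF V] Rep using y
      by (intro sum) (auto simp: jacobi_def)
    ultimately show "1 / K\<^sup>2 * (\<Sum>n\<in>{a..b}. (cmod (y n))\<^sup>2) \<le> (\<Sum>n\<in>{a..b}. (cmod (jacobi ?W y n))\<^sup>2)"
      using K(1) by (simp add: power_mult_distrib divide_le_eq)
  qed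
  with K(1) show ?thesis by (intro that[of "1 / K\<^sup>2"]) auto
qed

lemma sum_telescope_int:
  fixes g :: "int \<Rightarrow> 'a::ab_group_add"
  assumes "a \<le> b"
  shows "(\<Sum>n\<in>{a..b}. g n - g (n - 1)) = g b - g (a - 1)"
  using assms
proof (induction b rule: int_ge_induct)
  case (step i)
  then have "{a..i + 1} = insert (i + 1) {a..i}" by auto
  then show ?case using step by simp
qed simp

text \<open>In the imaginary part of the pairing of \<open>y\<close> with (H - z) y the hopping
  terms telescope away and the real \<open>V\<close> drops out, leaving \<open>- Im z\<close> times
  the squared norm of \<open>y\<close>.\<close>

lemma nonreal_bounded_below:
  fixes V :: "int \<Rightarrow> real" and z :: complex
  shows "bounded_below ((Im z)\<^sup>2) (\<lambda>n. complex_of_real (V n) - z)" (is "bounded_below _ ?W")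
  unfolding bounded_below_def
proof (intro allI impI)
  fix a b :: int and y :: "int \<Rightarrow> complex"
  assume y: "\<forall>n. n \<le> a \<or> b \<le> n \<longrightarrow> y n = 0"
  show "(Im z)\<^sup>2 * (\<Sum>n\<in>{a..b}. (cmod (y n))\<^sup>2) \<le> (\<Sum>n\<in>{a..b}. (cmod (jacobi ?W y n))\<^sup>2)"
  proof (cases "a \<le> b")
    case True
    \<comment> \<open>The current through the bond from \<open>n\<close> to \<open>n + 1\<close>. It
      vanishes outside the support of \<open>y\<close>, so its differences sum to 0.\<close>
    define J where "J n = Im (cnj (y n) * y (n + 1))" for n
    have J: "Im (cnj (y n) * jacobi ?W y n) = (J n - J (n - 1)) - Im z * (cmod (y n))\<^sup>2" for n
      by (simp add: J_def jacobi_def cmod_power2) (simp add: power2_eq_square algebra_simps)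
    have "(\<Sum>n\<in>{a..b}. Im (cnj (y n) * jacobi ?W y n))
        = (\<Sum>n\<in>{a..b}. J n - J (n - 1)) - Im z * (\<Sum>n\<in>{a..b}. (cmod (y n))\<^sup>2)"
      unfolding sum_distrib_left by (simp only: J sum_subtractf)
    moreover have "(\<Sum>n\<in>{a..b}. J n - J (n - 1)) = 0"
      using y by (simp add: sum_telescope_int[OF True]) (simp add: J_def)
    ultimately have "Im z * (\<Sum>n\<in>{a..b}. (cmod (y n))\<^sup>2) = - (\<Sum>n\<in>{a..b}. Im (cnj (y n) * jacobi ?W y n))"
      by simp
    then have "(Im z)\<^sup>2 * (\<Sum>n\<in>{a..b}. (cmod (y n))\<^sup>2) = (\<Sum>n\<in>{a..b}. - Im z * Im (cnj (y n) * jacobi ?W y n))"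
      by (simp only: power2_eq_square mult.assoc sum_distrib_left[symmetric])
    \<comment> \<open>Young's inequality with equal weights; half of the left side is absorbed at
      the end.\<close>
    also have "\<dots> \<le> (\<Sum>n\<in>{a..b}. ((Im z)\<^sup>2 * (cmod (y n))\<^sup>2 + (cmod (jacobi ?W y n))\<^sup>2) / 2)"
    proof (rule sum_mono)
      fix n
      have "- Im z * Im (cnj (y n) * jacobi ?W y n) \<le> \<bar>Im z\<bar> * \<bar>Im (cnj (y n) * jacobi ?W y n)\<bar>"
        by (metis abs_ge_self abs_minus_cancel abs_mult)
      also have "\<dots> \<le> \<bar>Im z\<bar> * (cmod (y n) * cmod (jacobi ?W y n))"
        using abs_Im_le_cmod[of "cnj (y n) * jacobi ?W y n"]
        by (intro mult_left_mono) (simp_all add: norm_mult)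
      also have "\<dots> \<le> ((Im z)\<^sup>2 * (cmod (y n))\<^sup>2 + (cmod (jacobi ?W y n))\<^sup>2) / 2"
        using sum_squares_bound[of "\<bar>Im z\<bar> * cmod (y n)" "cmod (jacobi ?W y n)"]
        by (simp add: power_mult_distrib)
      finally show "- Im z * Im (cnj (y n) * jacobi ?W y n)
          \<le> ((Im z)\<^sup>2 * (cmod (y n))\<^sup>2 + (cmod (jacobi ?W y n))\<^sup>2) / 2" .
    qed
    also have "\<dots> = ((Im z)\<^sup>2 * (\<Sum>n\<in>{a..b}. (cmod (y n))\<^sup>2) + (\<Sum>n\<in>{a..b}. (cmod (jacobi ?W y n))\<^sup>2)) / 2"
      by (simp add: sum_divide_distrib[symmetric] sum.distrib sum_distrib_left)
    finally show ?thesis by simp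
  qed simp
qed

text \<open>The sign \<open>e\<close> chooses the end of the integers, so that stable and unstable
  directions are treated together.\<close>

lemma tendsto_shift_int:
  fixes g :: "int \<Rightarrow> 'a::real_normed_vector"
  assumes lim: "(\<lambda>k. g (e * int k)) \<longlonglongrightarrow> 0" and e: "e = 1 \<or> e = - 1"
  shows "(\<lambda>k. g (e * int k + d)) \<longlonglongrightarrow> 0"
proof (rule LIMSEQ_I)
  fix \<epsilon> :: real assume "0 < \<epsilon>"
  then obtain N where N: "\<And>k. N \<le> k \<Longrightarrow> norm (g (e * int k)) < \<epsilon>"
    using LIMSEQ_D[OF lim] by fastforce
  show "\<exists>N. \<forall>k\<ge>N. norm (g (e * int k + d) - 0) < \<epsilon>"
  proof (intro exI allI impI)
    fix k assume "N + nat \<bar>d\<bar> \<le> k"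
    then have *: "N \<le> nat (int k + e * d)" "0 \<le> int k + e * d" using e by auto
    have "e * int (nat (int k + e * d)) = e * int k + d"
      using *(2) e by auto
    then show "norm (g (e * int k + d) - 0) < \<epsilon>" using N[OF *(1)] by simp
  qed
qed

section \<open>Real solutions and real phase vectors\<close>

lemma solves_Re_Im:
  assumes "solves W x" "\<And>n. Im (W n) = 0"
  shows "solves W (\<lambda>n. complex_of_real (Re (x n)))" "solves W (\<lambda>n. complex_of_real (Im (x n)))"
proof -
  have "jacobi W (\<lambda>n. complex_of_real (Re (x n))) n = complex_of_real (Re (jacobi W x n))"
    "jacobi W (\<lambda>n. complex_of_real (Im (x n))) n = complex_of_real (Im (jacobi W x n))" for n
    using assms(2)[of n] by (simp_all add: jacobi_def complex_eq_iff)
  then show "solves W (\<lambda>n. complex_of_real (Re (x n)))" "solves W (\<lambda>n. complex_of_real (Im (x n)))"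
    using assms(1) by (simp_all add: solves_def)
qed

text \<open>The counterpart of \<open>phase\<close> in the type on which the matrices act; for
  real-valued solutions \<open>Re\<close> loses nothing.\<close>

definition rphase :: "(int \<Rightarrow> complex) \<Rightarrow> int \<Rightarrow> real^2" where
  "rphase x n = vector [Re (x n), Re (x (n - 1))]"

lemma rphase_nth [simp]: "rphase x n $ 1 = Re (x n)" "rphase x n $ 2 = Re (x (n - 1))"
  by (simp_all add: rphase_def)

lemma norm_rphase:
  assumes "\<And>n. Im (x n) = 0"
  shows "norm (rphase x n) = norm (phase x n)"
  using assms by (simp add: phase_def norm_Pair norm_vec_def L2_set_def sum_2 cmod_def)

section \<open>Potentials sampled along the orbits of a homeomorphism\<close>

locale dynamical_potential =
  fixes T :: "'w::metric_space \<Rightarrow> 'w" and f :: "'w \<Rightarrow> real"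
  assumes compact: "compact (UNIV :: 'w set)"
    and homeo: "homeomorphism UNIV UNIV T (inv T)"
    and cont: "continuous_on UNIV f"
begin

lemma T_inv [simp]: "T (inv T \<omega>) = \<omega>" "inv T (T \<omega>) = \<omega>"
  using homeo by (simp_all add: homeomorphism_def)

lemma iterate_0 [simp]: "iterate T 0 \<omega> = \<omega>"
  by (simp add: iterate_def)

lemma iterate_Suc: "iterate T (n + 1) \<omega> = T (iterate T n \<omega>)"
proof (cases n)
  case (nonneg k)
  then show ?thesis by (simp add: iterate_def nat_add_distrib)
next
  case (neg k)
  then show ?thesis by (cases k) (simp_all add: iterate_def nat_add_distrib)
qed

lemma iterate_pred: "iterate T (n - 1) \<omega> = inv T (iterate T n \<omega>)"
  using iterate_Suc[of "n - 1" \<omega>] by simp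

lemma iterate_add: "iterate T (m + n) \<omega> = iterate T m (iterate T n \<omega>)"
proof (induction m rule: int_induct[where k = 0])
  case (step1 i)
  then show ?case using iterate_Suc[of "i + n" \<omega>] iterate_Suc[of i] by (simp add: add.commute add.left_commute)
next
  case (step2 i)
  then show ?case using iterate_pred[of "i + n" \<omega>] iterate_pred[of i] by (simp add: algebra_simps)
qed simp

lemma continuous_iterate: "continuous_on UNIV (iterate T n)"
proof (induction n rule: int_induct[where k = 0])
  case base
  show ?case by (simp add: iterate_def)
next
  case (step1 i)
  have "continuous_on UNIV (T \<circ> iterate T i)"
    using homeo step1 by (intro continuous_on_compose) (auto simp: homeomorphism_def intro: continuous_on_subset)
  then show ?case by (simp add: o_def iterate_Suc[symmetric])
next
  case (step2 i)
  have "continuous_on UNIV (inv T \<circ> iterate T i)"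
    using homeo step2 by (intro continuous_on_compose) (auto simp: homeomorphism_def intro: continuous_on_subset)
  then show ?case by (simp add: o_def iterate_pred[symmetric])
qed

lemma bounded_potential: "bounded (range (\<lambda>n. f (iterate T n \<omega>)))"
proof -
  have "bounded (range f)" by (intro compact_imp_bounded compact_continuous_image cont compact)
  then show ?thesis by (rule bounded_subset) auto
qed

definition pot :: "complex \<Rightarrow> 'w \<Rightarrow> int \<Rightarrow> complex" where
  "pot z \<omega> n = complex_of_real (f (iterate T n \<omega>)) - z"

lemma pot_iterate: "pot z (iterate T k \<omega>) n = pot z \<omega> (n + k)"
  by (simp add: pot_def iterate_add)

text \<open>For fixed \<open>y\<close> the inequality is a closed condition on \<omega>, as finitely
  many continuous functions enter. On the orbit of \<open>\<omega>\<^sub>0\<close> it follows by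
  translating \<open>y\<close>, and the orbit is dense.\<close>

lemma bounded_below_transfer:
  assumes dense: "closure (orbit T \<omega>\<^sub>0) = UNIV" and bb: "bounded_below c (pot z \<omega>\<^sub>0)"
  shows "bounded_below c (pot z \<omega>)"
  unfolding bounded_below_def
proof (intro allI impI)
  fix a b :: int and y :: "int \<Rightarrow> complex"
  assume y: "\<forall>n. n \<le> a \<or> b \<le> n \<longrightarrow> y n = 0"
  define S where "S = {\<omega>. c * (\<Sum>n\<in>{a..b}. (cmod (y n))\<^sup>2) \<le> (\<Sum>n\<in>{a..b}. (cmod (jacobi (pot z \<omega>) y n))\<^sup>2)}"
  have "continuous_on UNIV (\<lambda>\<omega>. f (iterate T n \<omega>))" for n
    by (rule continuous_on_compose2[OF cont continuous_iterate]) simp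
  then have "closed S"
    unfolding S_def jacobi_def pot_def by (intro closed_Collect_le continuous_intros)
  moreover have "orbit T \<omega>\<^sub>0 \<subseteq> S"
  proof
    fix \<omega> assume "\<omega> \<in> orbit T \<omega>\<^sub>0"
    then obtain k where k: "\<omega> = iterate T k \<omega>\<^sub>0" by (auto simp: orbit_def)
    have shift: "(\<Sum>n\<in>{a..b}. h n) = (\<Sum>n\<in>{a + k..b + k}. h (n - k))" for h :: "int \<Rightarrow> real"
      by (rule sum.reindex_bij_witness[of _ "\<lambda>n. n - k" "\<lambda>n. n + k"]) auto
    have "jacobi (pot z \<omega>) y (n - k) = jacobi (pot z \<omega>\<^sub>0) (\<lambda>n. y (n - k)) n" for n
      unfolding k by (simp add: jacobi_def pot_iterate algebra_simps)
    then show "\<omega> \<in> S"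
      using bounded_belowD[OF bb, of "a + k" "\<lambda>n. y (n - k)" "b + k"] y
      by (simp add: S_def shift)
  qed
  ultimately have "closure (orbit T \<omega>\<^sub>0) \<subseteq> S" by (rule closure_minimal[rotated])
  then show "c * (\<Sum>n\<in>{a..b}. (cmod (y n))\<^sup>2) \<le> (\<Sum>n\<in>{a..b}. (cmod (jacobi (pot z \<omega>) y n))\<^sup>2)"
    using dense by (auto simp: S_def)
qed

lemma dichotomy_not_in_dyn_spectrum:
  assumes "dichotomy (pot z \<omega>) p q C r"
  shows "z \<notin> spectrum (dyn_schrodinger T f \<omega>)"
  unfolding dyn_schrodinger_def
  using dichotomy_not_in_spectrum[OF bounded_potential, of \<omega> z p q C r] assms by (simp add: pot_def[abs_def])

lemma not_in_dyn_spectrum_bounded_below: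
  assumes "z \<notin> spectrum (dyn_schrodinger T f \<omega>)"
  obtains c where "0 < c" "bounded_below c (pot z \<omega>)"
  using not_in_spectrum_bounded_below[OF bounded_potential, of z \<omega>] assms
  unfolding dyn_schrodinger_def by (auto simp: pot_def[abs_def])

text \<open>The dichotomy and its Green kernel turn the lower bound into a two-sided inverse, for
  real and non-real \<open>z\<close> alike.\<close>

lemma bounded_below_not_in_dyn_spectrum:
  assumes "0 < c" "bounded_below c (pot z \<omega>)"
  shows "z \<notin> spectrum (dyn_schrodinger T f \<omega>)"
  using bounded_below_dichotomy[OF assms(2,1)] dichotomy_not_in_dyn_spectrum by metis

lemma dyn_spectrum_real:
  assumes "z \<in> spectrum (dyn_schrodinger T f \<omega>)"
  shows "Im z = 0"
proof (rule ccontr)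
  assume "Im z \<noteq> 0"
  then show False
    using bounded_below_not_in_dyn_spectrum[of "(Im z)\<^sup>2" z \<omega>] assms
      nonreal_bounded_below[of z "\<lambda>n. f (iterate T n \<omega>)"]
    by (simp add: pot_def[abs_def])
qed

section \<open>Transfer matrices and cocycles acting on solutions\<close>

lemma transfer_rphase:
  assumes "solves (pot (complex_of_real E) \<omega>) x"
  shows "transfer_matrix f E (iterate T n \<omega>) *v rphase x n = rphase x (n + 1)"
proof -
  have "Re (x (n + 1)) = - Re (x (n - 1)) - (f (iterate T n \<omega>) - E) * Re (x n)"
    using solvesD[OF assms, of n] by (simp add: pot_def)
  then show ?thesis
    by (simp add: vec_eq_iff forall_2 transfer_matrix_def matrix_vector_mult_def sum_2 algebra_simps)
qed

lemma det_forward_cocycle: "det (forward_cocycle T (transfer_matrix f E) k \<omega>) = 1"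
  by (induction k) (simp_all add: det_mul det_transfer_matrix)

lemma forward_cocycle_rphase:
  assumes "solves (pot (complex_of_real E) \<omega>) x"
  shows "forward_cocycle T (transfer_matrix f E) k (iterate T m \<omega>) *v rphase x m = rphase x (m + int k)"
proof (induction k)
  case (Suc k)
  have "(T ^^ k) (iterate T m \<omega>) = iterate T (m + int k) \<omega>"
    using iterate_add[of "int k" m \<omega>] by (simp add: iterate_def[of T "int k"] add.commute)
  then show ?case
    using Suc transfer_rphase[OF assms, of "m + int k"]
    by (simp add: matrix_vector_mul_assoc[symmetric] ac_simps)
qed simp

lemma cocycle_rphase:
  assumes x: "solves (pot (complex_of_real E) \<omega>) x"
  shows "cocycle T (transfer_matrix f E) n (iterate T m \<omega>) *v rphase x m = rphase x (m + n)"
proof (cases "n \<ge> 0")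
  case True
  then show ?thesis using forward_cocycle_rphase[OF x, of "nat n" m] by (simp add: cocycle_def)
next
  case False
  define F where "F = forward_cocycle T (transfer_matrix f E) (nat (- n)) (iterate T (m + n) \<omega>)"
  \<comment> \<open>Determinant one ensures that the choice in \<open>matrix_inv\<close> is an
    actual inverse.\<close>
  have "invertible F" by (simp add: F_def invertible_det_nz det_forward_cocycle)
  then have "matrix_inv F ** F = mat 1"
    unfolding matrix_inv_def invertible_def by (rule someI2_ex) simp
  then have "matrix_inv F *v (F *v v) = v" for v
    by (simp add: matrix_vector_mul_assoc)
  moreover have "F *v rphase x (m + n) = rphase x m"
    using forward_cocycle_rphase[OF x, of "nat (- n)" "m + n"] False by (simp add: F_def)
  ultimately have "matrix_inv F *v rphase x m = rphase x (m + n)" by metis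
  then show ?thesis
    using False iterate_add[of n m \<omega>] by (simp add: cocycle_def F_def add.commute)
qed

end

section \<open>Invariant lines and uniform hyperbolicity\<close>

lemma rphase_lincomb:
  "rphase (\<lambda>n. complex_of_real a * x n + complex_of_real b * y n) m = a *\<^sub>R rphase x m + b *\<^sub>R rphase y m"
  by (simp add: vec_eq_iff forall_2)

lemma tendsto_phase_zero_iff:
  "(\<lambda>k. phase x (g k)) \<longlonglongrightarrow> 0 \<longleftrightarrow> (\<lambda>k. x (g k)) \<longlonglongrightarrow> 0 \<and> (\<lambda>k. x (g k - 1)) \<longlonglongrightarrow> 0"
proof
  assume "(\<lambda>k. phase x (g k)) \<longlonglongrightarrow> 0"
  from tendsto_fst[OF this] tendsto_snd[OF this]
  show "(\<lambda>k. x (g k)) \<longlonglongrightarrow> 0 \<and> (\<lambda>k. x (g k - 1)) \<longlonglongrightarrow> 0" by (simp add: phase_def)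
next
  assume "(\<lambda>k. x (g k)) \<longlonglongrightarrow> 0 \<and> (\<lambda>k. x (g k - 1)) \<longlonglongrightarrow> 0"
  then show "(\<lambda>k. phase x (g k)) \<longlonglongrightarrow> 0"
    using tendsto_Pair[of "\<lambda>k. x (g k)" 0 sequentially "\<lambda>k. x (g k - 1)" 0]
    by (simp add: phase_def zero_prod_def)
qed

lemma norm_mult_unit_bound:
  fixes A :: "real^2^2"
  assumes "subspace L" "\<And>v. v \<in> L \<Longrightarrow> norm v = 1 \<Longrightarrow> norm (A *v v) \<le> K" "v \<in> L"
  shows "norm (A *v v) \<le> K * norm v"
proof (cases "v = 0")
  case False
  have "norm (A *v (v /\<^sub>R norm v)) \<le> K"
    using False by (intro assms(2) subspace_scale assms(1,3)) simp
  then show ?thesis using False by (simp add: scaleR_matrix_vector_assoc[symmetric] matrix_vector_mult_scaleR field_simps)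
qed simp

context dynamical_potential
begin

lemma Im_pot [simp]: "Im (pot (complex_of_real E) \<omega> n) = 0"
  by (simp add: pot_def)

text \<open>\<open>e = 1\<close> gives the stable and \<open>e = - 1\<close> the unstable direction.
  Collecting all real initial data that decay, instead of choosing a solution, lets invariance
  follow from shifting solutions.\<close>

definition decaying :: "int \<Rightarrow> real \<Rightarrow> 'w \<Rightarrow> (real^2) set" where
  "decaying e E \<omega> = {v. \<exists>x. solves (pot (complex_of_real E) \<omega>) x \<and> (\<forall>n. Im (x n) = 0) \<and>
     rphase x 0 = v \<and> (\<lambda>k. phase x (e * int k)) \<longlonglongrightarrow> 0}"

lemma decayingI:
  assumes "solves (pot (complex_of_real E) \<omega>) x" "\<And>n. Im (x n) = 0" "(\<lambda>k. phase x (e * int k)) \<longlonglongrightarrow> 0"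
  shows "rphase x 0 \<in> decaying e E \<omega>"
  using assms unfolding decaying_def by blast

lemma decayingE:
  assumes "v \<in> decaying e E \<omega>"
  obtains x where "solves (pot (complex_of_real E) \<omega>) x" "\<And>n. Im (x n) = 0" "rphase x 0 = v"
    "(\<lambda>k. phase x (e * int k)) \<longlonglongrightarrow> 0"
  using assms unfolding decaying_def by blast

lemma subspace_decaying: "subspace (decaying e E \<omega>)"
proof -
  have "a *\<^sub>R v + b *\<^sub>R w \<in> decaying e E \<omega>" if vw: "v \<in> decaying e E \<omega>" "w \<in> decaying e E \<omega>" for a b v w
  proof -
    obtain x where x: "solves (pot (complex_of_real E) \<omega>) x" "\<And>n. Im (x n) = 0" "rphase x 0 = v"
      "(\<lambda>k. phase x (e * int k)) \<longlonglongrightarrow> 0" by (rule decayingE[OF vw(1)]) blast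
    obtain y where y: "solves (pot (complex_of_real E) \<omega>) y" "\<And>n. Im (y n) = 0" "rphase y 0 = w"
      "(\<lambda>k. phase y (e * int k)) \<longlonglongrightarrow> 0" by (rule decayingE[OF vw(2)]) blast
    let ?z = "\<lambda>n. complex_of_real a * x n + complex_of_real b * y n"
    have "(\<lambda>k. phase ?z (e * int k)) \<longlonglongrightarrow> 0"
      using x(4) y(4) unfolding tendsto_phase_zero_iff
      by (auto intro!: tendsto_add_zero tendsto_mult_right_zero)
    then have "rphase ?z 0 \<in> decaying e E \<omega>"
      using x(2) y(2) by (intro decayingI solves_lincomb x(1) y(1)) simp_all
    then show ?thesis by (simp add: rphase_lincomb x(3) y(3))
  qed
  note lincomb = this
  have "v + w \<in> decaying e E \<omega>" if "v \<in> decaying e E \<omega>" "w \<in> decaying e E \<omega>" for v w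
    using lincomb[OF that, of 1 1] by simp
  moreover have "c *\<^sub>R v \<in> decaying e E \<omega>" if "v \<in> decaying e E \<omega>" for c v
    using lincomb[OF that that, of c 0] by simp
  moreover have "rphase (\<lambda>_. 0) 0 \<in> decaying e E \<omega>"
    by (rule decayingI) (simp_all add: solves_def jacobi_def phase_def zero_prod_def[symmetric])
  moreover have "rphase (\<lambda>_. 0) 0 = 0" by (simp add: vec_eq_iff forall_2)
  ultimately show ?thesis by (simp add: subspace_def)
qed

text \<open>The Wronskian of two such solutions is constant and tends to 0 along the decaying end,
  so it is 0.\<close>

lemma decaying_parallel:
  assumes vw: "v \<in> decaying e E \<omega>" "w \<in> decaying e E \<omega>"
  shows "v $ 1 * w $ 2 = v $ 2 * w $ 1"
proof -
  obtain x where x: "solves (pot (complex_of_real E) \<omega>) x" "\<And>n. Im (x n) = 0" "rphase x 0 = v"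
    "(\<lambda>k. phase x (e * int k)) \<longlonglongrightarrow> 0" by (rule decayingE[OF vw(1)]) blast
  obtain y where y: "solves (pot (complex_of_real E) \<omega>) y" "\<And>n. Im (y n) = 0" "rphase y 0 = w"
    "(\<lambda>k. phase y (e * int k)) \<longlonglongrightarrow> 0" by (rule decayingE[OF vw(2)]) blast
  have "(\<lambda>k. det_pair (phase x (e * int k)) (phase y (e * int k))) \<longlonglongrightarrow> det_pair 0 0"
    unfolding det_pair_def by (intro tendsto_diff tendsto_mult tendsto_fst tendsto_snd x(4) y(4))
  then have "(\<lambda>k::nat. det_pair (phase x 0) (phase y 0)) \<longlonglongrightarrow> 0"
    unfolding det_phase_const[OF x(1) y(1), of "e * int _"] by (simp add: det_pair_def)
  then have "Re (det_pair (phase x 0) (phase y 0)) = 0"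
    by (simp add: LIMSEQ_const_iff)
  then show ?thesis
    using x(2) y(2) by (simp add: det_pair_def phase_def x(3)[symmetric] y(3)[symmetric])
qed

text \<open>The given solution may be complex. Its real and imaginary parts solve the same equation
  and decay, one of them has nonzero phase at site 0, and by \<open>decaying_parallel\<close> that
  vector spans the space.\<close>

lemma decaying_RP1:
  assumes x: "solves (pot (complex_of_real E) \<omega>) x" "phase x 0 \<noteq> 0" "(\<lambda>k. phase x (e * int k)) \<longlonglongrightarrow> 0"
  shows "decaying e E \<omega> \<in> RP1"
proof -
  define a where "a n = complex_of_real (Re (x n))" for n
  define b where "b n = complex_of_real (Im (x n))" for n
  have "(\<lambda>k. phase a (e * int k)) \<longlonglongrightarrow> 0" "(\<lambda>k. phase b (e * int k)) \<longlonglongrightarrow> 0"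
    using x(3) tendsto_of_real[OF tendsto_Re] tendsto_of_real[OF tendsto_Im]
    unfolding tendsto_phase_zero_iff a_def b_def by (force intro: tendsto_eq_intros)+
  moreover have "solves (pot (complex_of_real E) \<omega>) a" "solves (pot (complex_of_real E) \<omega>) b"
    unfolding a_def b_def by (intro solves_Re_Im x Im_pot)+
  ultimately have mem: "rphase a 0 \<in> decaying e E \<omega>" "rphase b 0 \<in> decaying e E \<omega>"
    by (auto intro!: decayingI simp: a_def b_def)
  have "rphase a 0 \<noteq> 0 \<or> rphase b 0 \<noteq> 0"
    using x(2) by (auto simp: vec_eq_iff forall_2 a_def b_def phase_def zero_prod_def complex_eq_iff)
  then obtain v where v: "v \<in> decaying e E \<omega>" "v \<noteq> 0" using mem by blast
  have "decaying e E \<omega> = span {v}"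
  proof
    show "span {v} \<subseteq> decaying e E \<omega>"
      using v(1) by (intro span_minimal subspace_decaying) simp
    show "decaying e E \<omega> \<subseteq> span {v}"
    proof
      fix w assume "w \<in> decaying e E \<omega>"
      from decaying_parallel[OF v(1) this] have p: "v $ 1 * w $ 2 = v $ 2 * w $ 1" .
      consider "v $ 1 \<noteq> 0" | "v $ 2 \<noteq> 0" using v(2) by (auto simp: vec_eq_iff forall_2)
      then show "w \<in> span {v}"
      proof cases
        case 1
        then have "w = (w $ 1 / v $ 1) *\<^sub>R v" using p by (simp add: vec_eq_iff forall_2 field_simps)
        then show ?thesis by (metis insertI1 span_base span_scale)
      next
        case 2
        then have "w = (w $ 2 / v $ 2) *\<^sub>R v" using p by (simp add: vec_eq_iff forall_2 field_simps)
        then show ?thesis by (metis insertI1 span_base span_scale)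
      qed
    qed
  qed
  then show ?thesis using v(2) by (simp add: RP1_def)
qed

lemma solves_shift:
  assumes "solves (pot z \<omega>) x"
  shows "solves (pot z (iterate T d \<omega>)) (\<lambda>n. x (n + d))"
  unfolding solves_def jacobi_def pot_iterate
  using solvesD[OF assms, of "_ + d"] by (simp add: algebra_simps)

lemma decaying_iterate:
  assumes x: "solves (pot (complex_of_real E) \<omega>) x" "\<And>n. Im (x n) = 0"
    "(\<lambda>k. phase x (e * int k)) \<longlonglongrightarrow> 0" and e: "e = 1 \<or> e = - 1"
  shows "rphase x d \<in> decaying e E (iterate T d \<omega>)"
proof -
  have ph: "phase (\<lambda>n. x (n + d)) m = phase x (m + d)" for m
    by (simp add: phase_def algebra_simps)
  have "rphase (\<lambda>n. x (n + d)) 0 \<in> decaying e E (iterate T d \<omega>)"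
  proof (rule decayingI)
    show "solves (pot (complex_of_real E) (iterate T d \<omega>)) (\<lambda>n. x (n + d))"
      by (rule solves_shift[OF x(1)])
    show "(\<lambda>k. phase (\<lambda>n. x (n + d)) (e * int k)) \<longlonglongrightarrow> 0"
      unfolding ph by (rule tendsto_shift_int[OF x(3) e])
  qed (rule x(2))
  moreover have "rphase (\<lambda>n. x (n + d)) 0 = rphase x d" by (simp add: vec_eq_iff forall_2)
  ultimately show ?thesis by simp
qed

lemma line_action_decaying:
  assumes e: "e = 1 \<or> e = - 1"
  shows "line_action (transfer_matrix f E \<omega>) (decaying e E \<omega>) = decaying e E (T \<omega>)"
proof
  show "line_action (transfer_matrix f E \<omega>) (decaying e E \<omega>) \<subseteq> decaying e E (T \<omega>)"
    unfolding line_action_def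
  proof clarify
    fix v assume "v \<in> decaying e E \<omega>"
    then obtain x where x: "solves (pot (complex_of_real E) \<omega>) x" "\<And>n. Im (x n) = 0" "rphase x 0 = v"
      "(\<lambda>k. phase x (e * int k)) \<longlonglongrightarrow> 0" by (rule decayingE) blast
    show "transfer_matrix f E \<omega> *v v \<in> decaying e E (T \<omega>)"
      using decaying_iterate[OF x(1,2,4) e, of 1] transfer_rphase[OF x(1), of 0] iterate_Suc[of 0 \<omega>]
      by (simp add: x(3))
  qed
  show "decaying e E (T \<omega>) \<subseteq> line_action (transfer_matrix f E \<omega>) (decaying e E \<omega>)"
  proof
    fix v assume "v \<in> decaying e E (T \<omega>)"
    then obtain x where x: "solves (pot (complex_of_real E) (T \<omega>)) x" "\<And>n. Im (x n) = 0" "rphase x 0 = v"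
      "(\<lambda>k. phase x (e * int k)) \<longlonglongrightarrow> 0" by (rule decayingE) blast
    \<comment> \<open>Seen from \<open>T \<omega>\<close>, site -1 lies over \<omega>, so
      \<open>rphase x (- 1)\<close> serves as the preimage.\<close>
    have it: "iterate T (- 1) (T \<omega>) = \<omega>" using iterate_pred[of 0 "T \<omega>"] by simp
    have "transfer_matrix f E \<omega> *v rphase x (- 1) = v"
      using transfer_rphase[OF x(1), of "- 1"] by (simp add: it x(3))
    moreover have "rphase x (- 1) \<in> decaying e E \<omega>"
      using decaying_iterate[OF x(1,2,4) e, of "- 1"] by (simp add: it)
    ultimately show "v \<in> line_action (transfer_matrix f E \<omega>) (decaying e E \<omega>)"
      unfolding line_action_def by (metis imageI)
  qed
qed

text \<open>The two line fields are the initial data decaying at minus and at plus infinity. A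
  common \<open>c\<close> for all \<omega> makes the constants uniform.\<close>

lemma bounded_below_uniformly_hyperbolic:
  assumes c: "0 < c" and bb: "\<And>\<omega>. bounded_below c (pot (complex_of_real E) \<omega>)"
  shows "uniformly_hyperbolic T (transfer_matrix f E)"
proof -
  \<comment> \<open>Puts the decay into the required form, with expansion rate
    \<open>1 / decay_rate c\<close> above 1.\<close>
  have pw: "(1 / decay_rate c) powi (- int n) = decay_rate c ^ n" for n
    by (simp add: power_int_minus power_divide)
  have "range (decaying (- 1) E) \<subseteq> RP1"
  proof clarify
    fix \<omega>
    obtain x where "solves (pot (complex_of_real E) \<omega>) x" "phase x 0 \<noteq> 0" "(\<lambda>k. phase x (- int k)) \<longlonglongrightarrow> 0"
      using bounded_below_decaying_solution_backward[OF bb c] .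
    then show "decaying (- 1) E \<omega> \<in> RP1" by (intro decaying_RP1[of E \<omega> x]) simp_all
  qed
  moreover have "range (decaying 1 E) \<subseteq> RP1"
  proof clarify
    fix \<omega>
    obtain x where "solves (pot (complex_of_real E) \<omega>) x" "phase x 0 \<noteq> 0" "(\<lambda>k. phase x (int k)) \<longlonglongrightarrow> 0"
      using bounded_below_decaying_solution[OF bb c] .
    then show "decaying 1 E \<omega> \<in> RP1" by (intro decaying_RP1[of E \<omega> x]) simp_all
  qed
  moreover have "norm (cocycle T (transfer_matrix f E) (- int n) \<omega> *v v) \<le> decay_const c * (1 / decay_rate c) powi (- int n)"
    if v: "v \<in> decaying (- 1) E \<omega>" "norm v = 1" for n \<omega> v
  proof -
    obtain x where x: "solves (pot (complex_of_real E) \<omega>) x" "\<And>n. Im (x n) = 0" "rphase x 0 = v"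
      "(\<lambda>k. phase x (- 1 * int k)) \<longlonglongrightarrow> 0" by (rule decayingE[OF v(1)]) blast
    have "norm (rphase x (- int n)) \<le> decay_const c * decay_rate c ^ n * norm (rphase x 0)"
      using bounded_below_decay_backward[OF bb c x(1), of "- int n" n] x(4)
      by (simp add: norm_rphase[OF x(2)])
    moreover have "cocycle T (transfer_matrix f E) (- int n) \<omega> *v v = rphase x (- int n)"
      using cocycle_rphase[OF x(1), of "- int n" 0] by (simp add: x(3))
    ultimately show ?thesis by (simp only: x(3) v(2) pw mult_1_right)
  qed
  moreover have "norm (cocycle T (transfer_matrix f E) (int n) \<omega> *v v) \<le> decay_const c * (1 / decay_rate c) powi (- int n)"
    if v: "v \<in> decaying 1 E \<omega>" "norm v = 1" for n \<omega> v
  proof -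
    obtain x where x: "solves (pot (complex_of_real E) \<omega>) x" "\<And>n. Im (x n) = 0" "rphase x 0 = v"
      "(\<lambda>k. phase x (1 * int k)) \<longlonglongrightarrow> 0" by (rule decayingE[OF v(1)]) blast
    have "norm (rphase x (int n)) \<le> decay_const c * decay_rate c ^ n * norm (rphase x 0)"
      using bounded_below_decay[OF bb c x(1), of 0 n] x(4)
      by (simp add: norm_rphase[OF x(2)])
    moreover have "cocycle T (transfer_matrix f E) (int n) \<omega> *v v = rphase x (int n)"
      using cocycle_rphase[OF x(1), of "int n" 0] by (simp add: x(3))
    ultimately show ?thesis by (simp only: x(3) v(2) pw mult_1_right)
  qed
  moreover have "0 < decay_const c" "1 < 1 / decay_rate c"
    using decay_const_rate[OF c] by simp_all
  ultimately show ?thesis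
    unfolding uniformly_hyperbolic_def
    by (intro exI[of _ "decaying (- 1) E"] exI[of _ "decaying 1 E"] exI[of _ "decay_const c"]
        exI[of _ "1 / decay_rate c"] conjI allI impI ballI) (simp_all only: line_action_decaying simp_thms)
qed

text \<open>A nonzero vector of one line generates a solution, and invariance keeps its phase in the
  line field in both directions. Contraction along lines thereby becomes contraction of a
  solution.\<close>

lemma invariant_line_solution:
  assumes L: "range L \<subseteq> RP1" and inv: "\<And>\<omega>. line_action (transfer_matrix f E \<omega>) (L \<omega>) = L (T \<omega>)"
  obtains x where "solves (pot (complex_of_real E) \<omega>) x" "\<And>n. Im (x n) = 0"
    "phase x 0 \<noteq> 0" "\<And>n. rphase x n \<in> L (iterate T n \<omega>)"
proof -
  have "L \<omega> \<in> RP1" using L by blast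
  then have sub: "subspace (L \<omega>)" and dim: "dim (L \<omega>) = 1" by (simp_all add: RP1_def)
  have "L \<omega> \<noteq> {0}" using dim by (metis dim_singleton zero_neq_one)
  then obtain v where v: "v \<in> L \<omega>" "v \<noteq> 0" using subspace_0[OF sub] by blast
  obtain y where y: "solves (pot (complex_of_real E) \<omega>) y" "y 0 = complex_of_real (v $ 1)"
    "y (- 1) = complex_of_real (v $ 2)" using solves_exists by metis
  \<comment> \<open>The real part keeps the real initial data and still solves the equation, because
    the potential is real.\<close>
  define x where "x n = complex_of_real (Re (y n))" for n
  have x: "solves (pot (complex_of_real E) \<omega>) x"
    unfolding x_def by (intro solves_Re_Im y Im_pot)
  have Im: "Im (x n) = 0" for n by (simp add: x_def)
  have x0: "rphase x 0 = v" by (simp add: vec_eq_iff forall_2 x_def y)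
  have "rphase x n \<in> L (iterate T n \<omega>)" for n
  proof (induction n rule: int_induct[where k = 0])
    case base
    then show ?case using v x0 by simp
  next
    case (step1 i)
    then have "transfer_matrix f E (iterate T i \<omega>) *v rphase x i \<in> L (T (iterate T i \<omega>))"
      unfolding inv[symmetric] line_action_def by blast
    then show ?case by (simp add: transfer_rphase[OF x] iterate_Suc)
  next
    case (step2 i)
    let ?A = "transfer_matrix f E (iterate T (i - 1) \<omega>)"
    have "rphase x i \<in> line_action ?A (L (iterate T (i - 1) \<omega>))"
      using step2 iterate_Suc[of "i - 1" \<omega>] by (simp add: inv)
    then obtain w where w: "w \<in> L (iterate T (i - 1) \<omega>)" "rphase x i = ?A *v w"
      unfolding line_action_def by blast
    \<comment> \<open>Going backward, injectivity of the transfer matrix identifies the preimage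
      \<open>w\<close> in the line with the phase at \<open>i - 1\<close>.\<close>
    have "?A *v rphase x (i - 1) = ?A *v w"
      using transfer_rphase[OF x, of "i - 1"] w(2) by simp
    moreover have "inj ((*v) ?A)"
      by (intro inj_matrix_vector_mult) (simp add: invertible_det_nz det_transfer_matrix)
    ultimately have "rphase x (i - 1) = w" by (simp add: inj_eq)
    then show ?case using w(1) by simp
  qed
  moreover have "phase x 0 \<noteq> 0"
    using norm_rphase[of x 0, OF Im] v(2) by (metis norm_eq_zero x0)
  ultimately show ?thesis using that x Im by blast
qed

lemma uniformly_hyperbolic_not_in_spectrum:
  assumes "uniformly_hyperbolic T (transfer_matrix f E)"
  shows "complex_of_real E \<notin> spectrum (dyn_schrodinger T f \<omega>)"
proof -
  let ?A = "transfer_matrix f E"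
  obtain u s C l where us: "range u \<subseteq> RP1" "range s \<subseteq> RP1"
    and inv: "\<And>\<omega>. line_action (?A \<omega>) (u \<omega>) = u (T \<omega>)" "\<And>\<omega>. line_action (?A \<omega>) (s \<omega>) = s (T \<omega>)"
    and Cl: "0 < C" "1 < l"
    and uc: "\<And>n \<omega> v. 1 \<le> n \<Longrightarrow> v \<in> u \<omega> \<Longrightarrow> norm v = 1 \<Longrightarrow> norm (cocycle T ?A (- int n) \<omega> *v v) \<le> C * l powi (- int n)"
    and sc: "\<And>n \<omega> v. 1 \<le> n \<Longrightarrow> v \<in> s \<omega> \<Longrightarrow> norm v = 1 \<Longrightarrow> norm (cocycle T ?A (int n) \<omega> *v v) \<le> C * l powi (- int n)"
    using assms unfolding uniformly_hyperbolic_def by metis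
  have pw: "l powi (- int n) = (1 / l) ^ n" for n
    by (simp add: power_int_minus power_divide inverse_eq_divide)
  note uc = uc[unfolded pw] and sc = sc[unfolded pw]
  have sub: "subspace (u \<omega>)" "subspace (s \<omega>)" for \<omega>
    using us by (auto simp: RP1_def)
  obtain p where p: "solves (pot (complex_of_real E) \<omega>) p" "\<And>n. Im (p n) = 0"
    "phase p 0 \<noteq> 0" "\<And>n. rphase p n \<in> u (iterate T n \<omega>)"
    using invariant_line_solution[OF us(1) inv(1)] by blast
  obtain q where q: "solves (pot (complex_of_real E) \<omega>) q" "\<And>n. Im (q n) = 0"
    "phase q 0 \<noteq> 0" "\<And>n. rphase q n \<in> s (iterate T n \<omega>)"
    using invariant_line_solution[OF us(2) inv(2)] by blast
  \<comment> \<open>Uniform hyperbolicity speaks of \<open>n\<close> at least 1, a dichotomy also of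
    \<open>k = 0\<close>, where the constant has to be at least 1.\<close>
  define D where "D = max C 1"
  have CD: "C * (1 / l) ^ k \<le> D * (1 / l) ^ k" for k
    using Cl by (intro mult_right_mono) (simp_all add: D_def)
  have "norm (phase p m) \<le> D * (1 / l) ^ k * norm (phase p (m + int k))" for m k
  proof (cases "k = 0")
    case False
    \<comment> \<open>The backward estimate is used at the base point over \<open>m + k\<close>,
      from which \<open>k\<close> steps back lead to \<open>m\<close>.\<close>
    have "norm (cocycle T ?A (- int k) (iterate T (m + int k) \<omega>) *v rphase p (m + int k))
        \<le> C * (1 / l) ^ k * norm (rphase p (m + int k))"
      using False by (intro norm_mult_unit_bound[OF sub(1) _ p(4)] uc) simp_all
    also have "\<dots> \<le> D * (1 / l) ^ k * norm (rphase p (m + int k))"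
      by (rule mult_right_mono[OF CD norm_ge_zero])
    finally show ?thesis
      by (simp add: cocycle_rphase[OF p(1)] norm_rphase[OF p(2)])
  qed (simp add: D_def mult_le_cancel_right1)
  moreover have "norm (phase q (m + int k)) \<le> D * (1 / l) ^ k * norm (phase q m)" for m k
  proof (cases "k = 0")
    case False
    have "norm (cocycle T ?A (int k) (iterate T m \<omega>) *v rphase q m) \<le> C * (1 / l) ^ k * norm (rphase q m)"
      using False by (intro norm_mult_unit_bound[OF sub(2) _ q(4)] sc) simp_all
    also have "\<dots> \<le> D * (1 / l) ^ k * norm (rphase q m)"
      by (rule mult_right_mono[OF CD norm_ge_zero])
    finally show ?thesis
      by (simp add: cocycle_rphase[OF q(1)] norm_rphase[OF q(2)])
  qed (simp add: D_def mult_le_cancel_right1)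
  ultimately have "dichotomy (pot (complex_of_real E) \<omega>) p q D (1 / l)"
    using p(1,3) q(1,3) Cl by (simp add: dichotomy_def D_def)
  then show ?thesis by (rule dichotomy_not_in_dyn_spectrum)
qed

end

theorem theorem4:
  fixes T :: "'w::metric_space \<Rightarrow> 'w" and f :: "'w \<Rightarrow> real" and \<omega>\<^sub>0 :: 'w
    and \<Sigma> :: "complex set"
  assumes "compact (UNIV :: 'w set)"
    and "homeomorphism UNIV UNIV T (inv T)"
    and "continuous_on UNIV f"
    and "topologically_transitive T"
    and "closure (orbit T \<omega>\<^sub>0) = UNIV"
    and "\<Sigma> = spectrum (dyn_schrodinger T f \<omega>\<^sub>0)"
  shows "(\<forall>\<omega>. spectrum (dyn_schrodinger T f \<omega>) \<subseteq> \<Sigma>) \<and>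
         \<Sigma> = complex_of_real ` {E. \<not> uniformly_hyperbolic T (transfer_matrix f E)}"
proof -
  interpret dynamical_potential T f
    by standard (rule assms)+
  note dense = assms(5) and \<Sigma> = assms(6)
  \<comment> \<open>Density of the orbit spreads the lower bound from
    \<open>\<omega>\<^sub>0\<close> to every \<omega> with the same \<open>c\<close>. The inclusion
    of spectra and the hyperbolicity outside \<Sigma> both come from this.\<close>
  have uniform: "\<exists>c>0. \<forall>\<omega>. bounded_below c (pot z \<omega>)" if "z \<notin> \<Sigma>" for z
    using not_in_dyn_spectrum_bounded_below[of z \<omega>\<^sub>0] bounded_below_transfer[OF dense] that
    unfolding \<Sigma> by metis
  have "spectrum (dyn_schrodinger T f \<omega>) \<subseteq> \<Sigma>" for \<omega>
    using uniform bounded_below_not_in_dyn_spectrum by blast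
  moreover have "\<Sigma> = complex_of_real ` {E. \<not> uniformly_hyperbolic T (transfer_matrix f E)}"
  proof (intro equalityI subsetI)
    fix z assume z: "z \<in> \<Sigma>"
    \<comment> \<open>The spectrum is real, so \<open>Re z\<close> is the energy to test.\<close>
    then have "z = complex_of_real (Re z)"
      using dyn_spectrum_real unfolding \<Sigma> by (simp add: complex_eq_iff)
    moreover from this z have "\<not> uniformly_hyperbolic T (transfer_matrix f (Re z))"
      using uniformly_hyperbolic_not_in_spectrum unfolding \<Sigma> by metis
    ultimately show "z \<in> complex_of_real ` {E. \<not> uniformly_hyperbolic T (transfer_matrix f E)}"
      by blast
  next
    fix z assume "z \<in> complex_of_real ` {E. \<not> uniformly_hyperbolic T (transfer_matrix f E)}"
    then obtain E where E: "z = complex_of_real E" "\<not> uniformly_hyperbolic T (transfer_matrix f E)" by blast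
    \<comment> \<open>By contraposition: outside \<Sigma> the uniform lower bound forces uniform
      hyperbolicity.\<close>
    then show "z \<in> \<Sigma>"
      using uniform[of z] bounded_below_uniformly_hyperbolic by blast
  qed
  ultimately show ?thesis by blast
qed

end
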